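(* Let $\rho>0$, $\beta>0$, $a>0$. For each $n\ge 1$ let $\sigma=\sigma_n>0$, $\gamma=\gamma_n>0$, $\tau=\tau_n>0$ be parameters such that $\tfrac12\sigma^2\tau n^2=\beta$ and $\gamma\tau n=a$. Let $Z_t$ be the stationary Ornstein-Uhlenbeck process $dZ_t=-\gamma Z_t\,dt+\sigma\,dW_t$ (with $Z_0\sim N(0,\frac{\sigma^2}{2\gamma})$ independent of $W$), sampled at the times $t_i=i\tau$, $Z_i:=Z_{t_i}$, and let $x_n$ be obtained after $n$ steps of the recursion $$x_{i+1}=\left(1+\rho\, e^{Z_i-\frac12\mathrm{Var}(Z_i)}\right)x_i,\qquad i=0,1,\dots,n-1,\qquad x_0=1 .$$ Then the limit $\lambda(\rho,\beta,a):=\lim_{n\to\infty}\frac1n\log\mathbb{E}[x_n]$, taken at fixed $\rho,\beta,a$, exists and is given by $$\lambda(\rho,\beta,a)=\sup_{g\in\mathcal{G}}\Lambda[g],$$ where $$\Lambda[g]=\log\rho\; g(1)+\beta\int_0^1\!\!\int_0^1 g'(y)\,g'(z)\,K(y,z)\,dy\,dz-\int_0^1 I(g'(x))\,dx,$$ $$K(y,z)=\frac{1}{2a}e^{-a|y-z|},\qquad I(x)=x\log x+(1-x)\log(1-x),$$ and $$\mathcal{G}=\{g:[0,1]\to[0,1]\;|\; g(0)=0,\ g\text{ absolutely continuous},\ 0\le g'(x)\le 1\}.$$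
   Context: Convention: $0\log 0=0$, so $I(0)=I(1)=0$; the condition $0\le g'\le1$ is understood almost everywhere. $W$ is a standard Brownian motion. The parameters $\sigma,\gamma,\tau$ vary with $n$ so that $\beta=\frac12\sigma^2\tau n^2$ and $a=\gamma\tau n$ stay fixed. For each $n$, $(Z_0,\dots,Z_{n-1})$ is a centered Gaussian vector with $\mathrm{cov}(Z_i,Z_j)=\frac{\sigma^2}{2\gamma}e^{-\gamma\tau|i-j|}=\frac{\beta}{an}e^{-\frac an|i-j|}$. *)

theory Defs
  imports "HOL-Probability.Probability"
begin

section \<open>Brownian motion and the stationary Ornstein-Uhlenbeck process\<close>

context prob_space
begin

(* Processes are indexed by the reals; only times t >= 0 are constrained. *)
definition standard_brownian_motion :: "(real \<Rightarrow> 'a \<Rightarrow> real) \<Rightarrow> bool" where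
  "standard_brownian_motion W \<longleftrightarrow>
     (\<forall>t\<ge>0. random_variable borel (W t)) \<and>
     (AE \<omega> in M. W 0 \<omega> = 0) \<and>
     (AE \<omega> in M. continuous_on {0..} (\<lambda>t. W t \<omega>)) \<and>
     (\<forall>s t. 0 \<le> s \<and> s < t \<longrightarrow>
        distributed M lborel (\<lambda>\<omega>. W t \<omega> - W s \<omega>) (normal_density 0 (sqrt (t - s)))) \<and>
     (\<forall>(k::nat) t. 0 \<le> t 0 \<and> (\<forall>i<k. t i < t (Suc i)) \<longrightarrow>
        indep_vars (\<lambda>_. borel) (\<lambda>i \<omega>. W (t (Suc i)) \<omega> - W (t i) \<omega>) {..<k})"

(* Independence of a random variable and a whole process, via the generated sigma-algebras;
   indep_var does not apply because it requires both variables to have the same value type. *)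
definition indep_of_process :: "('a \<Rightarrow> real) \<Rightarrow> (real \<Rightarrow> 'a \<Rightarrow> real) \<Rightarrow> bool" where
  "indep_of_process X W \<longleftrightarrow>
     indep_set
       (sets (vimage_algebra (space M) X borel))
       (sets (vimage_algebra (space M) (\<lambda>\<omega>. \<lambda>t\<in>{0..}. W t \<omega>) (\<Pi>\<^sub>M t\<in>{0..}. borel)))"

(* The equation dZ = - \<gamma> Z dt + \<sigma> dW. Since \<sigma> is constant, the stochastic integral
   of \<sigma> against W over [0, t] is \<sigma> (W t - W 0), so the integral form of the equation only
   involves a pathwise Lebesgue integral. The initial law is the stationary one. *)
definition stationary_OU ::
  "real \<Rightarrow> real \<Rightarrow> (real \<Rightarrow> 'a \<Rightarrow> real) \<Rightarrow> (real \<Rightarrow> 'a \<Rightarrow> real) \<Rightarrow> bool" where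
  "stationary_OU \<gamma> \<sigma> W Z \<longleftrightarrow>
     (\<forall>t\<ge>0. random_variable borel (Z t)) \<and>
     distributed M lborel (Z 0) (normal_density 0 (sqrt (\<sigma>\<^sup>2 / (2 * \<gamma>)))) \<and>
     indep_of_process (Z 0) W \<and>
     (AE \<omega> in M. continuous_on {0..} (\<lambda>t. Z t \<omega>)) \<and>
     (AE \<omega> in M. \<forall>t\<ge>0.
        Z t \<omega> = Z 0 \<omega> - \<gamma> * (LINT s:{0..t}|lborel. Z s \<omega>) + \<sigma> * (W t \<omega> - W 0 \<omega>))"

primrec growth_process :: "real \<Rightarrow> (nat \<Rightarrow> 'a \<Rightarrow> real) \<Rightarrow> nat \<Rightarrow> 'a \<Rightarrow> real" where
  "growth_process \<rho> Y 0 \<omega> = 1"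
| "growth_process \<rho> Y (Suc i) \<omega> =
     (1 + \<rho> * exp (Y i \<omega> - variance (Y i) / 2)) * growth_process \<rho> Y i \<omega>"

end

section \<open>The variational problem\<close>

definition abs_continuous_on_interval :: "real \<Rightarrow> real \<Rightarrow> (real \<Rightarrow> real) \<Rightarrow> bool" where
  "abs_continuous_on_interval a b f \<longleftrightarrow>
     (\<forall>\<epsilon>>0. \<exists>\<delta>>0. \<forall>(k::nat) u v.
        (\<forall>i<k. a \<le> u i \<and> u i \<le> v i \<and> v i \<le> b) \<and>
        disjoint_family_on (\<lambda>i. {u i<..<v i}) {..<k} \<and>
        (\<Sum>i<k. v i - u i) < \<delta> \<longrightarrow>
        (\<Sum>i<k. \<bar>f (v i) - f (u i)\<bar>) < \<epsilon>)"

(* Functions on [0, 1] are represented by total functions whose values outside [0, 1] play no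
   role: derivatives are only used at almost every point of [0, 1]. *)
definition \<G> :: "(real \<Rightarrow> real) set" where
  "\<G> = {g. g \<in> {0..1} \<rightarrow> {0..1} \<and> g 0 = 0 \<and> abs_continuous_on_interval 0 1 g \<and>
        (AE x\<in>{0..1} in lborel. g differentiable (at x) \<and> 0 \<le> deriv g x \<and> deriv g x \<le> 1)}"

definition K :: "real \<Rightarrow> real \<Rightarrow> real \<Rightarrow> real" where
  "K a y z = 1 / (2 * a) * exp (- a * \<bar>y - z\<bar>)"

(* The convention 0 log 0 = 0 holds automatically, as the factor 0 annihilates the logarithm. *)
definition entropy_fun :: "real \<Rightarrow> real" where
  "entropy_fun x = x * ln x + (1 - x) * ln (1 - x)"

definition \<Lambda> :: "real \<Rightarrow> real \<Rightarrow> real \<Rightarrow> (real \<Rightarrow> real) \<Rightarrow> real" where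
  "\<Lambda> \<rho> \<beta> a g =
     ln \<rho> * g 1
     + \<beta> * (LINT y:{0..1}|lebesgue. LINT z:{0..1}|lebesgue. deriv g y * deriv g z * K a y z)
     - (LINT x:{0..1}|lebesgue. entropy_fun (deriv g x))"

end

theory Submission
  imports Defs "HOL-Real_Asymp.Real_Asymp"
begin

text \<open>The interaction has strength of order \<open>1 / n\<close> and a Lipschitz profile,
  which is why mean field is exact to leading order. With blocks of length \<open>l\<close>,
  freezing the kernel on blocks costs \<open>2 * \<beta> * l\<close> in the exponent and the choice
  of the counts costs about \<open>(n / l) * ln n\<close>; both are \<open>o(n)\<close> when
  \<open>l\<close> is about \<open>sqrt n\<close>. The factor 1/2 in a Gaussian exponential moment
  turns the covariance \<open>\<beta> / (a * n) * exp (...)\<close> into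
  \<open>(\<beta> / n) * K\<close>. The correction by half the variance in the recursion removes the
  diagonal of the quadratic form; it is at most \<open>\<beta> / (2 * a * n)\<close> per site, hence
  at most \<open>\<beta> / (2 * a)\<close> in total. The process is given only through its integral
  equation, so the Gaussian law of its samples has to be derived. The noise is additive, so it
  cancels exactly in the error of the Euler scheme, and no stochastic integral is involved. Absolute
  continuity makes \<open>g 1\<close> the integral of the derivative; after that the functional
  depends on the density alone.\<close>

text \<open>
  The Euler scheme for the equation of \<open>Z\<close> is a linear image of independent Gaussians and
  converges pathwise at the sampling times, so that sums of sampled values are Gaussian. Expanding
  the product, \<open>E[x\<^sub>n]\<close> becomes the partition function of a lattice gas on \<open>{0..<n}\<close> with the smooth
  long-range interaction \<open>(\<beta>/n) K(i/n, j/n)\<close>; adding the diagonal terms changes its logarithm by at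
  most \<open>\<beta>/(2a)\<close>.

  Lower bound: by the Gibbs variational principle with product Bernoulli trial measures, the
  log-partition function dominates the mean-field functional of every vector of occupation
  probabilities; for the increments of \<open>g\<close> over the cells \<open>[i/n, (i+1)/n]\<close>, Jensen's inequality
  bounds this functional from below by \<open>n \<Lambda>[g] - \<beta>\<close>.

  Upper bound: cut \<open>{0..<n}\<close> into blocks of length about \<open>\<surd>n\<close>. The energy of a configuration is
  determined up to \<open>O(\<surd>n)\<close> by its block counts, there are only \<open>exp(O(\<surd>n log n))\<close> possible counts, and
  the configurations with given counts contribute at most the exponential of the mean-field
  functional at the block densities, which is at most \<open>n \<Lambda>[g] + \<beta>\<close> for a piecewise linear \<open>g\<close>.
\<close>

section \<open>Gaussian laws via characteristic functions\<close>

lemma (in prob_space) char_distr_scale: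
  assumes [measurable]: "random_variable borel X"
  shows "char (distr M borel (\<lambda>\<omega>. c * X \<omega>)) t = char (distr M borel X) (c * t)"
  by (simp add: char_def integral_distr mult_ac)

lemma (in prob_space) char_distr_normal:
  assumes X: "distributed M lborel X (normal_density 0 s)" and s: "s > 0"
  shows "char (distr M borel X) t = complex_of_real (exp (- (s\<^sup>2 * t\<^sup>2) / 2))"
proof -
  have [measurable]: "random_variable borel X"
    using distributed_measurable[OF X] by simp
  have "distributed M lborel (\<lambda>x. (X x - 0) / s) std_normal_density"
    using X normal_standard_normal_convert[OF s] by blast
  then have D: "distr M lborel (\<lambda>x. X x / s) = density lborel std_normal_density"
    by (simp add: distributed_def)
  have "distr M borel (\<lambda>x. X x / s) = distr M lborel (\<lambda>x. X x / s)"
    by (rule distr_cong) simp_all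
  then have E: "distr M borel (\<lambda>x. X x / s) = std_normal_distribution"
    using D by simp
  have "char (distr M borel X) t = char (distr M borel (\<lambda>x. X x / s)) (s * t)"
    using s by (simp add: char_def integral_distr)
  then show ?thesis
    unfolding E char_std_normal_distribution by (simp add: power_mult_distrib)
qed

lemma (in prob_space) distributed_normal_of_char:
  assumes [measurable]: "random_variable borel X" and v: "v > 0"
    and ch: "\<And>t. char (distr M borel X) t = complex_of_real (exp (- (v * t\<^sup>2) / 2))"
  shows "distributed M lborel X (normal_density 0 (sqrt v))"
proof -
  have sq: "sqrt v > 0" using v by simp
  have "char (distr M borel (\<lambda>x. X x / sqrt v)) = char std_normal_distribution"
  proof
    fix t
    have "char (distr M borel (\<lambda>x. X x / sqrt v)) t = char (distr M borel X) (t / sqrt v)"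
      by (simp add: char_def integral_distr mult_ac)
    also have "\<dots> = char std_normal_distribution t"
      using v unfolding ch char_std_normal_distribution by (simp add: power_divide)
    finally show "char (distr M borel (\<lambda>x. X x / sqrt v)) t = char std_normal_distribution t" .
  qed
  moreover have "real_distribution (distr M borel (\<lambda>x. X x / sqrt v))"
    by (rule real_distribution_distr) simp
  ultimately have "distr M borel (\<lambda>x. X x / sqrt v) = std_normal_distribution"
    using Levy_uniqueness real_dist_normal_dist by blast
  moreover have "distr M borel (\<lambda>x. X x / sqrt v) = distr M lborel (\<lambda>x. X x / sqrt v)"
    by (rule distr_cong) simp_all
  ultimately have "distributed M lborel (\<lambda>x. (X x - 0) / sqrt v) std_normal_density"
    by (simp add: distributed_def)
  then show ?thesis
    using normal_standard_normal_convert[OF sq] by blast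
qed

lemma (in prob_space) has_bochner_integral_exp_normal:
  assumes X: "distributed M lborel X (normal_density 0 s)" and s: "s > 0"
  shows "has_bochner_integral M (\<lambda>\<omega>. exp (X \<omega>)) (exp (s\<^sup>2 / 2))"
proof -
  \<comment> \<open>Completing the square: tilting a centered normal law of variance
    \<open>s\<^sup>2\<close> by \<open>exp x\<close> moves its mean to \<open>s\<^sup>2\<close> and
    leaves the constant \<open>exp (s\<^sup>2 / 2)\<close>.\<close>
  have eq: "normal_density 0 s x * exp x = exp (s\<^sup>2 / 2) * normal_density (s\<^sup>2) s x" for x
  proof -
    have "- (x - 0)\<^sup>2 / (2 * s\<^sup>2) + x = s\<^sup>2 / 2 + - (x - s\<^sup>2)\<^sup>2 / (2 * s\<^sup>2)"
      using s by (simp add: field_simps power2_eq_square)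
    then have "exp (- (x - 0)\<^sup>2 / (2 * s\<^sup>2)) * exp x = exp (s\<^sup>2 / 2) * exp (- (x - s\<^sup>2)\<^sup>2 / (2 * s\<^sup>2))"
      by (simp flip: exp_add)
    then show ?thesis
      unfolding normal_density_def by (simp add: mult_ac)
  qed
  have "integrable M (\<lambda>\<omega>. exp (X \<omega>))"
  proof (subst distributed_integrable[OF X, of exp, symmetric])
    show "integrable lborel (\<lambda>x. normal_density 0 s x * exp x)"
      unfolding eq using s by simp
  qed auto
  moreover have "expectation (\<lambda>\<omega>. exp (X \<omega>)) = exp (s\<^sup>2 / 2)"
  proof (subst distributed_integral[OF X, of exp, symmetric])
    show "(\<integral>x. normal_density 0 s x * exp x \<partial>lborel) = exp (s\<^sup>2 / 2)"
      unfolding eq using s by simp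
  qed auto
  ultimately show ?thesis
    by (simp add: has_bochner_integral_iff)
qed

text \<open>The integrands have modulus 1, so dominated convergence applies. This carries the
  Gaussian law from the Euler scheme to its almost sure limit.\<close>

lemma (in prob_space) char_distr_limit:
  assumes [measurable]: "\<And>m. random_variable borel (X m)" "random_variable borel Y"
    and lim: "AE \<omega> in M. (\<lambda>m. X m \<omega>) \<longlonglongrightarrow> Y \<omega>"
  shows "(\<lambda>m. char (distr M borel (X m)) t) \<longlonglongrightarrow> char (distr M borel Y) t"
  unfolding char_def
  by (simp add: integral_distr, rule integral_dominated_convergence[where w="\<lambda>_. 1"])
     (use lim in \<open>auto elim!: eventually_mono intro!: tendsto_intros\<close>)

section \<open>The Ornstein-Uhlenbeck process at the sampling times\<close>

text \<open>In the applications \<open>q = 1 - \<gamma> * h\<close> for the step size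
  \<open>h\<close>, and \<open>D k\<close> is the increment of \<open>W\<close> over step
  \<open>k\<close>. The scheme is linear in \<open>z\<close> and \<open>D\<close>, which makes its
  values Gaussian.\<close>

primrec euler_scheme :: "real \<Rightarrow> real \<Rightarrow> real \<Rightarrow> (nat \<Rightarrow> real) \<Rightarrow> nat \<Rightarrow> real" where
  "euler_scheme q \<sigma> z D 0 = z"
| "euler_scheme q \<sigma> z D (Suc k) = q * euler_scheme q \<sigma> z D k + \<sigma> * D k"

lemma euler_scheme_eq:
  "euler_scheme q \<sigma> z D k = q ^ k * z + (\<Sum>j<k. \<sigma> * q ^ (k - Suc j) * D j)"
proof (induction k)
  case (Suc k)
  have "(\<Sum>j<k. \<sigma> * q ^ (Suc k - Suc j) * D j) = q * (\<Sum>j<k. \<sigma> * q ^ (k - Suc j) * D j)"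
    by (auto simp: sum_distrib_left Suc_diff_Suc simp flip: power_Suc intro!: sum.cong)
  then show ?case
    by (simp add: Suc algebra_simps)
qed simp

lemma OU_path_increment:
  fixes z w :: "real \<Rightarrow> real"
  assumes cont: "continuous_on {0..} z"
    and eq: "\<And>t. t \<ge> 0 \<Longrightarrow> z t = z 0 - \<gamma> * (LINT s:{0..t}|lborel. z s) + \<sigma> * (w t - w 0)"
    and ab: "0 \<le> u" "u \<le> v"
  shows "z v - z u = \<sigma> * (w v - w u) - \<gamma> * (LINT s:{u<..v}|lborel. z s)"
    and "set_integrable lborel {u<..v} z"
proof -
  have i: "set_integrable lborel {0..v} z"
    by (rule borel_integrable_atLeastAtMost') (use cont continuous_on_subset in fastforce)
  have i1: "set_integrable lborel {0..u} z" and i2: "set_integrable lborel {u<..v} z"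
    by (rule set_integrable_subset[OF i]; use ab in force)+
  have "{0..v} = {0..u} \<union> {u<..v}" using ab by auto
  then have "(LINT s:{0..v}|lborel. z s) = (LINT s:{0..u}|lborel. z s) + (LINT s:{u<..v}|lborel. z s)"
    using i1 i2 by (simp add: set_integral_Un ivl_disj_int)
  then show "z v - z u = \<sigma> * (w v - w u) - \<gamma> * (LINT s:{u<..v}|lborel. z s)"
    using eq[of u] eq[of v] ab by (simp add: algebra_simps)
  show "set_integrable lborel {u<..v} z" by fact
qed

text \<open>Since \<open>0 \<le> 1 - \<gamma> * h \<le> 1\<close>, past errors are never amplified
  and the local errors simply add up. One step contributes at most
  \<open>\<gamma> * h * \<epsilon>\<close>, where \<open>\<epsilon>\<close> bounds the oscillation
  of the path within a step.\<close>

lemma euler_scheme_error: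
  fixes z w :: "real \<Rightarrow> real"
  assumes cont: "continuous_on {0..} z"
    and eq: "\<And>t. t \<ge> 0 \<Longrightarrow> z t = z 0 - \<gamma> * (LINT s:{0..t}|lborel. z s) + \<sigma> * (w t - w 0)"
    and h: "h > 0" and \<gamma>: "\<gamma> > 0" and small: "\<gamma> * h \<le> 1"
    and osc: "\<And>s t. 0 \<le> t \<Longrightarrow> t \<le> s \<Longrightarrow> s \<le> T \<Longrightarrow> s - t \<le> h \<Longrightarrow> \<bar>z s - z t\<bar> \<le> \<epsilon>"
    and k: "real k * h \<le> T"
  shows "\<bar>euler_scheme (1 - \<gamma> * h) \<sigma> (z 0) (\<lambda>j. w (real (Suc j) * h) - w (real j * h)) k - z (real k * h)\<bar>
           \<le> real k * h * \<gamma> * \<epsilon>"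
  using k
proof (induction k)
  case (Suc k)
  let ?E = "euler_scheme (1 - \<gamma> * h) \<sigma> (z 0) (\<lambda>j. w (real (Suc j) * h) - w (real j * h))"
  let ?u = "real k * h" and ?v = "real (Suc k) * h"
  have vu: "?v = ?u + h" by (simp add: algebra_simps)
  have uv: "0 \<le> ?u" "?u \<le> ?v" "?v \<le> T" using h Suc.prems by (auto simp: vu)
  note inc = OU_path_increment[OF cont eq uv(1,2)]
  have c: "set_integrable lborel {?u<..?v} (\<lambda>_. x)" for x :: real
    by (rule set_integrable_subset[OF borel_integrable_atLeastAtMost'[of ?u ?v]]) auto
  have int: "set_integrable lborel {?u<..?v} (\<lambda>s. z s - z ?u)"
    by (intro set_integral_diff inc(2) c)
  have lc: "(LINT s:{?u<..?v}|lborel. x) = h * x" for x :: real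
    using h by (simp add: set_integral_const vu del: of_nat_Suc)
  have I: "(LINT s:{?u<..?v}|lborel. z s - z ?u) = (LINT s:{?u<..?v}|lborel. z s) - h * z ?u"
    using set_integral_diff(2)[OF inc(2) c[of "z ?u"]] unfolding lc .
  have pt: "\<bar>z s - z ?u\<bar> \<le> \<epsilon>" if "s \<in> {?u<..?v}" for s
    using osc[of ?u s] that uv by (auto simp: vu simp del: of_nat_Suc)
  have "\<bar>LINT s:{?u<..?v}|lborel. z s - z ?u\<bar> \<le> (LINT s:{?u<..?v}|lborel. \<epsilon>)"
    unfolding set_lebesgue_integral_def
  proof (rule order_trans[OF integral_abs_bound integral_mono])
    show "integrable lborel (\<lambda>s. \<bar>indicat_real {?u<..?v} s *\<^sub>R (z s - z ?u)\<bar>)"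
      using int unfolding set_integrable_def by (rule integrable_abs)
    show "integrable lborel (\<lambda>s. indicat_real {?u<..?v} s *\<^sub>R \<epsilon>)"
      using c unfolding set_integrable_def .
  qed (use pt in \<open>auto split: split_indicator simp del: of_nat_Suc\<close>)
  also have "\<dots> = h * \<epsilon>" by (rule lc)
  finally have J: "\<bar>LINT s:{?u<..?v}|lborel. z s - z ?u\<bar> \<le> h * \<epsilon>" .
  \<comment> \<open>The noise increment occurs identically in the scheme and in the equation and
    drops out.\<close>
  have "?E (Suc k) - z ?v = (1 - \<gamma> * h) * (?E k - z ?u) + \<gamma> * (LINT s:{?u<..?v}|lborel. z s - z ?u)"
    using inc(1) unfolding I by (simp add: algebra_simps)
  also have "\<bar>\<dots>\<bar> \<le> 1 * \<bar>?E k - z ?u\<bar> + \<gamma> * (h * \<epsilon>)"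
    using small \<gamma> h J
    by (intro abs_triangle_ineq[THEN order_trans] add_mono) (auto simp: abs_mult intro!: mult_left_le_one_le)
  also have "\<dots> \<le> real (Suc k) * h * \<gamma> * \<epsilon>"
    using Suc.IH uv by (simp add: algebra_simps)
  finally show ?case .
qed simp

text \<open>The step \<open>\<tau> / Suc m\<close> divides \<open>\<tau>\<close>, so the sampling
  time \<open>i * \<tau>\<close> is exactly the grid point number \<open>i * Suc m\<close>. Uniform
  continuity of the path on a compact interval controls its oscillation.\<close>

lemma euler_scheme_tendsto:
  fixes z w :: "real \<Rightarrow> real"
  assumes cont: "continuous_on {0..} z"
    and eq: "\<And>t. t \<ge> 0 \<Longrightarrow> z t = z 0 - \<gamma> * (LINT s:{0..t}|lborel. z s) + \<sigma> * (w t - w 0)"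
    and \<tau>: "\<tau> > 0" and \<gamma>: "\<gamma> > 0"
  shows "(\<lambda>m. euler_scheme (1 - \<gamma> * (\<tau> / real (Suc m))) \<sigma> (z 0)
             (\<lambda>j. w (real (Suc j) * (\<tau> / real (Suc m))) - w (real j * (\<tau> / real (Suc m)))) (i * Suc m))
           \<longlonglongrightarrow> z (real i * \<tau>)"
proof (rule LIMSEQ_I)
  fix r :: real assume r: "r > 0"
  define T where "T = real i * \<tau>"
  \<comment> \<open>This choice gives \<open>T * \<gamma> * \<epsilon> < r\<close>; the summand 1
    keeps the denominator positive when \<open>T = 0\<close>.\<close>
  define \<epsilon> where "\<epsilon> = r / (2 * (T * \<gamma> + 1))"
  have T: "T \<ge> 0" using \<tau> by (simp add: T_def)
  have \<epsilon>: "\<epsilon> > 0" using T \<gamma> r by (auto simp: \<epsilon>_def intro!: divide_pos_pos add_nonneg_pos)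
  have "uniformly_continuous_on {0..T} z"
    by (rule compact_uniformly_continuous) (use cont continuous_on_subset in fastforce, simp)
  then obtain d where d: "d > 0"
    and dd: "\<And>s t. s \<in> {0..T} \<Longrightarrow> t \<in> {0..T} \<Longrightarrow> \<bar>s - t\<bar> < d \<Longrightarrow> \<bar>z s - z t\<bar> < \<epsilon>"
    unfolding uniformly_continuous_on_def dist_real_def using \<epsilon> by (metis abs_minus_commute)
  \<comment> \<open>The two summands enforce the two demands on the step, \<open>h < d\<close> and
    \<open>\<gamma> * h \<le> 1\<close>.\<close>
  obtain N where N: "real N > \<tau> / d + \<gamma> * \<tau>" using reals_Archimedean2 by blast
  show "\<exists>no. \<forall>m\<ge>no. norm (euler_scheme (1 - \<gamma> * (\<tau> / real (Suc m))) \<sigma> (z 0)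
             (\<lambda>j. w (real (Suc j) * (\<tau> / real (Suc m))) - w (real j * (\<tau> / real (Suc m)))) (i * Suc m)
            - z (real i * \<tau>)) < r"
  proof (intro exI allI impI)
    fix m assume m: "N \<le> m"
    define h where "h = \<tau> / real (Suc m)"
    have h: "h > 0" using \<tau> by (simp add: h_def)
    have mm: "real (Suc m) > \<tau> / d + \<gamma> * \<tau>" using N m by linarith
    have p: "\<tau> / d > 0" "\<gamma> * \<tau> > 0" using \<tau> d \<gamma> by auto
    have hd: "h < d"
    proof -
      have "\<tau> / d < real (Suc m)" using mm p by linarith
      then show ?thesis using d by (simp add: h_def field_simps)
    qed
    have hg: "\<gamma> * h \<le> 1"
    proof -
      have "\<gamma> * \<tau> \<le> real (Suc m)" using mm p by linarith
      then show ?thesis by (simp add: h_def field_simps)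
    qed
    have hT: "real (i * Suc m) * h = T" by (simp add: h_def T_def field_simps)
    have "\<bar>euler_scheme (1 - \<gamma> * h) \<sigma> (z 0) (\<lambda>j. w (real (Suc j) * h) - w (real j * h)) (i * Suc m)
            - z (real (i * Suc m) * h)\<bar> \<le> real (i * Suc m) * h * \<gamma> * \<epsilon>"
    proof (rule euler_scheme_error[OF cont eq h \<gamma> hg, where T=T])
      fix s t assume "0 \<le> t" "t \<le> s" "s \<le> T" "s - t \<le> h"
      then show "\<bar>z s - z t\<bar> \<le> \<epsilon>" using dd[of s t] hd by auto
    qed (use hT in auto)
    also have "\<dots> = T * \<gamma> * \<epsilon>" unfolding hT ..
    also have "\<dots> < r"
    proof -
      have "T * \<gamma> * r < r * (2 * (T * \<gamma> + 1))" using T \<gamma> r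
        by (smt (verit) mult.commute mult_nonneg_nonneg mult_pos_pos mult_strict_left_mono)
      then show ?thesis using T \<gamma> by (simp add: \<epsilon>_def divide_less_eq add_nonneg_pos)
    qed
    finally show "norm (euler_scheme (1 - \<gamma> * (\<tau> / real (Suc m))) \<sigma> (z 0)
             (\<lambda>j. w (real (Suc j) * (\<tau> / real (Suc m))) - w (real j * (\<tau> / real (Suc m)))) (i * Suc m)
            - z (real i * \<tau>)) < r"
      unfolding hT unfolding T_def h_def by simp
  qed
qed

section \<open>Covariances of the Euler scheme and their limit\<close>

text \<open>Coefficient of the \<open>r\<close>-th noise increment in step \<open>k\<close> of the Euler scheme, up to the factor \<open>\<sigma>\<close>.\<close>

definition euler_weight :: "real \<Rightarrow> nat \<Rightarrow> nat \<Rightarrow> real" where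
  "euler_weight q k r = (if r < k then q ^ (k - Suc r) else 0)"

text \<open>Only the first \<open>k\<close> noises enter both values. On them the later weight is
  \<open>q ^ (l - k)\<close> times the earlier one, so a geometric series in
  \<open>q\<^sup>2\<close> remains.\<close>

lemma sum_euler_weight_le:
  assumes "k \<le> l" "l \<le> N" and q: "q\<^sup>2 \<noteq> 1"
  shows "(\<Sum>r<N. euler_weight q k r * euler_weight q l r) = q ^ (l - k) * (1 - (q\<^sup>2) ^ k) / (1 - q\<^sup>2)"
proof -
  have "(\<Sum>r<N. euler_weight q k r * euler_weight q l r) = (\<Sum>r<k. euler_weight q k r * euler_weight q l r)"
    by (rule sum.mono_neutral_right) (use assms in \<open>auto simp: euler_weight_def\<close>)
  also have "\<dots> = (\<Sum>r<k. q ^ (l - k) * (q\<^sup>2) ^ (k - Suc r))"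
  proof (rule sum.cong)
    fix r assume r: "r \<in> {..<k}"
    then have "l - Suc r = (l - k) + (k - Suc r)" using assms by auto
    then have e: "q ^ (l - Suc r) = q ^ (l - k) * q ^ (k - Suc r)" by (simp only: power_add)
    then show "euler_weight q k r * euler_weight q l r = q ^ (l - k) * (q\<^sup>2) ^ (k - Suc r)"
      using r assms by (simp add: euler_weight_def e power2_eq_square power_mult_distrib)
  qed simp
  also have "\<dots> = q ^ (l - k) * (\<Sum>r<k. (q\<^sup>2) ^ r)"
    by (simp add: sum.nat_diff_reindex[of "\<lambda>r. (q\<^sup>2) ^ r"] flip: sum_distrib_left)
  also have "\<dots> = q ^ (l - k) * (1 - (q\<^sup>2) ^ k) / (1 - q\<^sup>2)"
    using q by (simp add: sum_gp_strict)
  finally show ?thesis .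
qed

lemma sum_euler_weight:
  assumes "k \<le> N" "l \<le> N" and q: "q\<^sup>2 \<noteq> 1"
  shows "(\<Sum>r<N. euler_weight q k r * euler_weight q l r)
           = q ^ (max k l - min k l) * (1 - (q\<^sup>2) ^ min k l) / (1 - q\<^sup>2)"
proof (cases "k \<le> l")
  case True
  then show ?thesis using sum_euler_weight_le[of k l N q] assms by (simp add: max_def min_def)
next
  case False
  then show ?thesis using sum_euler_weight_le[of l k N q] assms
    by (simp add: max_def min_def mult.commute)
qed

lemma euler_power_tendsto:
  "(\<lambda>m. (1 - \<gamma> * (\<tau> / real (Suc m))) ^ (i * Suc m)) \<longlonglongrightarrow> exp (- (\<gamma> * \<tau> * real i))"
proof -
  have "(\<lambda>m. (1 + (- (\<gamma> * \<tau>)) / real (Suc m)) ^ Suc m) \<longlonglongrightarrow> exp (- (\<gamma> * \<tau>))"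
    by (rule LIMSEQ_Suc[OF tendsto_exp_limit_sequentially])
  then have "(\<lambda>m. ((1 - \<gamma> * (\<tau> / real (Suc m))) ^ Suc m) ^ i) \<longlonglongrightarrow> exp (- (\<gamma> * \<tau>)) ^ i"
    by (intro tendsto_power) simp
  moreover have "exp (- (\<gamma> * \<tau>)) ^ i = exp (- (\<gamma> * \<tau> * real i))"
    by (simp add: mult.commute flip: exp_of_nat_mult)
  ultimately show ?thesis
    by (simp only: power_mult[symmetric] mult.commute[of "Suc _" i])
qed

text \<open>The summands are the contributions of the initial value and of the common noise to a
  covariance. With \<open>s = \<sigma>\<^sup>2 / (2 * \<gamma>)\<close> and
  \<open>c = \<gamma> * \<tau>\<close> they tend to \<open>s * exp (- c * (i + j))\<close> and
  \<open>s * exp (- c * \<bar>i - j\<bar>) * (1 - exp (- 2 * c * min i j))\<close>. As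
  \<open>i + j = \<bar>i - j\<bar> + 2 * min i j\<close>, the first cancels the negative part of the
  second: the initial variance is the stationary one.\<close>

lemma euler_covariance_tendsto:
  fixes \<gamma> \<sigma> \<tau> :: real
  assumes pos: "\<gamma> > 0" "\<tau> > 0" and ij: "i \<le> N" "j \<le> N"
  defines "q \<equiv> \<lambda>m. 1 - \<gamma> * (\<tau> / real (Suc m))"
  shows "(\<lambda>m. q m ^ (i * Suc m) * q m ^ (j * Suc m) * (\<sigma>\<^sup>2 / (2 * \<gamma>))
             + \<sigma>\<^sup>2 * (\<tau> / real (Suc m)) *
               (\<Sum>r<N * Suc m. euler_weight (q m) (i * Suc m) r * euler_weight (q m) (j * Suc m) r))
         \<longlonglongrightarrow> \<sigma>\<^sup>2 / (2 * \<gamma>) * exp (- (\<gamma> * \<tau> * \<bar>real i - real j\<bar>))"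
proof -
  define h where "h m = \<tau> / real (Suc m)" for m
  define u where "u = max i j - min i j"
  have h0: "h \<longlonglongrightarrow> 0" unfolding h_def
    by (rule LIMSEQ_Suc[OF lim_const_over_n])
  have hpos: "h m > 0" for m using pos by (simp add: h_def)
  have qh: "q m = 1 - \<gamma> * h m" for m by (simp add: q_def h_def)
  have pw: "(\<lambda>m. q m ^ (k * Suc m)) \<longlonglongrightarrow> exp (- (\<gamma> * \<tau> * real k))" for k
    unfolding q_def by (rule euler_power_tendsto)
  have "(\<lambda>m. q m ^ (i * Suc m) * q m ^ (j * Suc m) * (\<sigma>\<^sup>2 / (2 * \<gamma>))
          + \<sigma>\<^sup>2 / (\<gamma> * (2 - \<gamma> * h m)) * (q m ^ (u * Suc m) * (1 - (q m ^ (min i j * Suc m))\<^sup>2)))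
        \<longlonglongrightarrow> exp (- (\<gamma> * \<tau> * real i)) * exp (- (\<gamma> * \<tau> * real j)) * (\<sigma>\<^sup>2 / (2 * \<gamma>))
          + \<sigma>\<^sup>2 / (\<gamma> * (2 - \<gamma> * 0)) * (exp (- (\<gamma> * \<tau> * real u)) * (1 - (exp (- (\<gamma> * \<tau> * real (min i j))))\<^sup>2))"
    by (intro tendsto_intros pw h0) (use pos in auto)
  also have "exp (- (\<gamma> * \<tau> * real i)) * exp (- (\<gamma> * \<tau> * real j)) * (\<sigma>\<^sup>2 / (2 * \<gamma>))
          + \<sigma>\<^sup>2 / (\<gamma> * (2 - \<gamma> * 0)) * (exp (- (\<gamma> * \<tau> * real u)) * (1 - (exp (- (\<gamma> * \<tau> * real (min i j))))\<^sup>2))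
        = \<sigma>\<^sup>2 / (2 * \<gamma>) * exp (- (\<gamma> * \<tau> * \<bar>real i - real j\<bar>))"
  proof -
    have u: "real u = \<bar>real i - real j\<bar>" by (auto simp: u_def)
    have "real i + real j = real u + 2 * real (min i j)" by (auto simp: u_def)
    then have "- (\<gamma> * \<tau> * (real i + real j)) = - (\<gamma> * \<tau> * (real u + 2 * real (min i j)))" by simp
    then have "- (\<gamma> * \<tau> * real i) + - (\<gamma> * \<tau> * real j)
        = - (\<gamma> * \<tau> * real u) + (- (\<gamma> * \<tau> * real (min i j)) + - (\<gamma> * \<tau> * real (min i j)))"
      by (simp only: distrib_left)
    then have "exp (- (\<gamma> * \<tau> * real i)) * exp (- (\<gamma> * \<tau> * real j))
        = exp (- (\<gamma> * \<tau> * real u)) * (exp (- (\<gamma> * \<tau> * real (min i j))))\<^sup>2"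
      by (simp only: power2_eq_square exp_add[symmetric])
    then show ?thesis unfolding u[symmetric] by (simp add: algebra_simps)
  qed
  finally have lim: "(\<lambda>m. q m ^ (i * Suc m) * q m ^ (j * Suc m) * (\<sigma>\<^sup>2 / (2 * \<gamma>))
          + \<sigma>\<^sup>2 / (\<gamma> * (2 - \<gamma> * h m)) * (q m ^ (u * Suc m) * (1 - (q m ^ (min i j * Suc m))\<^sup>2)))
        \<longlonglongrightarrow> \<sigma>\<^sup>2 / (2 * \<gamma>) * exp (- (\<gamma> * \<tau> * \<bar>real i - real j\<bar>))" .
  have ev: "\<forall>\<^sub>F m in sequentially. \<gamma> * h m < 2"
    using order_tendstoD(2)[OF tendsto_mult_left[OF h0, of \<gamma>], of 2] by simp
  show ?thesis
  proof (rule Lim_transform_eventually[OF lim], use ev in eventually_elim)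
    fix m assume m: "\<gamma> * h m < 2"
    have gh: "\<gamma> * h m > 0" using pos hpos by simp
    \<comment> \<open>The factor \<open>h m\<close> here cancels the one in the noise variance
      \<open>\<sigma>\<^sup>2 * h m\<close>. The bounds \<open>0 < \<gamma> * h m < 2\<close> keep
      \<open>q m\<close> away from 1 and -1, where the geometric sum formula breaks down.\<close>
    have q1: "1 - (q m)\<^sup>2 = \<gamma> * h m * (2 - \<gamma> * h m)"
      by (simp add: qh power2_eq_square algebra_simps)
    then have "(q m)\<^sup>2 \<noteq> 1" using m gh by auto
    moreover have "i * Suc m \<le> N * Suc m" "j * Suc m \<le> N * Suc m"
      by (rule mult_le_mono1[OF ij(1)], rule mult_le_mono1[OF ij(2)])
    ultimately have "(\<Sum>r<N * Suc m. euler_weight (q m) (i * Suc m) r * euler_weight (q m) (j * Suc m) r)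
        = q m ^ (max (i * Suc m) (j * Suc m) - min (i * Suc m) (j * Suc m))
            * (1 - ((q m)\<^sup>2) ^ min (i * Suc m) (j * Suc m)) / (1 - (q m)\<^sup>2)"
      by (intro sum_euler_weight)
    also have "min (i * Suc m) (j * Suc m) = min i j * Suc m"
      by (rule nat_mult_min_left[symmetric])
    also have "max (i * Suc m) (j * Suc m) = max i j * Suc m"
      by (rule nat_mult_max_left[symmetric])
    also have "max i j * Suc m - min i j * Suc m = u * Suc m"
      by (simp only: u_def diff_mult_distrib)
    also have "((q m)\<^sup>2) ^ (min i j * Suc m) = (q m ^ (min i j * Suc m))\<^sup>2"
      by (simp only: power_mult[symmetric] mult.commute)
    finally have S: "(\<Sum>r<N * Suc m. euler_weight (q m) (i * Suc m) r * euler_weight (q m) (j * Suc m) r)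
        = q m ^ (u * Suc m) * (1 - (q m ^ (min i j * Suc m))\<^sup>2) / (\<gamma> * h m * (2 - \<gamma> * h m))"
      unfolding q1 .
    have "\<sigma>\<^sup>2 * h m * (x / (\<gamma> * h m * (2 - \<gamma> * h m))) = \<sigma>\<^sup>2 / (\<gamma> * (2 - \<gamma> * h m)) * x" for x
      using hpos[of m] by simp
    then show "q m ^ (i * Suc m) * q m ^ (j * Suc m) * (\<sigma>\<^sup>2 / (2 * \<gamma>))
          + \<sigma>\<^sup>2 / (\<gamma> * (2 - \<gamma> * h m)) * (q m ^ (u * Suc m) * (1 - (q m ^ (min i j * Suc m))\<^sup>2))
        = q m ^ (i * Suc m) * q m ^ (j * Suc m) * (\<sigma>\<^sup>2 / (2 * \<gamma>))
             + \<sigma>\<^sup>2 * (\<tau> / real (Suc m)) *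
               (\<Sum>r<N * Suc m. euler_weight (q m) (i * Suc m) r * euler_weight (q m) (j * Suc m) r)"
      unfolding S h_def[symmetric] by simp
  qed
qed

section \<open>Gaussian law of sums of samples and the expected product\<close>

text \<open>Independence of the initial value from the process is stated for generated
  sigma-algebras; this extracts independence from a single functional of the path, as the addition
  rule for characteristic functions requires.\<close>

lemma (in prob_space) indep_var_of_process:
  assumes ind: "indep_of_process X W"
    and X: "random_variable borel X"
    and W: "\<And>t. t \<ge> 0 \<Longrightarrow> random_variable borel (W t)"
    and Y: "Y \<in> borel_measurable (vimage_algebra (space M) (\<lambda>\<omega>. \<lambda>t\<in>{0..}. W t \<omega>) (\<Pi>\<^sub>M t\<in>{0..}. borel))"
  shows "indep_var borel X borel Y"
proof -
  let ?F = "vimage_algebra (space M) (\<lambda>\<omega>. \<lambda>t\<in>{0..}. W t \<omega>) (\<Pi>\<^sub>M t\<in>{0..}. borel)"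
  let ?G = "vimage_algebra (space M) X borel"
  have "(\<lambda>\<omega>. \<lambda>t\<in>{0..}. W t \<omega>) \<in> measurable M (\<Pi>\<^sub>M t\<in>{0..}. borel)"
    using W by (intro measurable_restrict) auto
  then have "sets ?F \<subseteq> sets M"
    by (simp add: measurable_iff_sets)
  then have Ym: "random_variable borel Y"
    using Y by (auto simp: measurable_def space_vimage_algebra)
  have sX: "sigma_sets (space M) {X -` A \<inter> space M |A. A \<in> sets borel} \<subseteq> sets ?G"
    by (auto simp: sets_vimage_algebra)
  have "{Y -` A \<inter> space M |A. A \<in> sets borel} \<subseteq> sets ?F"
    using Y by (auto simp: measurable_def space_vimage_algebra)
  then have sY: "sigma_sets (space M) {Y -` A \<inter> space M |A. A \<in> sets borel} \<subseteq> sets ?F"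
    using sets.sigma_sets_subset[of _ ?F] by (simp add: space_vimage_algebra)
  have "indep_set (sets ?G) (sets ?F)"
    using ind by (simp add: indep_of_process_def)
  then have "indep_set (sigma_sets (space M) {X -` A \<inter> space M |A. A \<in> sets borel})
      (sigma_sets (space M) {Y -` A \<inter> space M |A. A \<in> sets borel})"
    unfolding indep_set_def
    by (rule indep_sets_mono_sets) (use sX sY in \<open>auto split: bool.split\<close>)
  then show ?thesis
    using X Ym by (simp add: indep_var_eq)
qed

text \<open>Summing the scheme at the grid indices \<open>c i\<close> gives \<open>A * Z 0\<close>
  plus a linear combination of the first \<open>N\<close> increments, all independent, so the
  characteristic function factorises. Increments after step \<open>c i\<close> enter with weight 0,
  which allows one \<open>N\<close> for all indices.\<close>

lemma (in prob_space) char_euler_sum: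
  assumes W: "standard_brownian_motion W" and Z: "stationary_OU \<gamma> \<sigma> W Z"
    and pos: "\<gamma> > 0" "\<sigma> > 0" "h > 0" and c: "\<And>i. i \<in> S \<Longrightarrow> c i \<le> N"
  shows "char (distr M borel (\<lambda>\<omega>. \<Sum>i\<in>S. euler_scheme q \<sigma> (Z 0 \<omega>)
            (\<lambda>j. W (real (Suc j) * h) \<omega> - W (real j * h) \<omega>) (c i))) t
       = complex_of_real (exp (- ((\<Sum>i\<in>S. \<Sum>j\<in>S. q ^ c i * q ^ c j * (\<sigma>\<^sup>2 / (2 * \<gamma>))
             + \<sigma>\<^sup>2 * h * (\<Sum>r<N. euler_weight q (c i) r * euler_weight q (c j) r)) * t\<^sup>2) / 2))"
proof -
  define D where "D r \<omega> = W (real (Suc r) * h) \<omega> - W (real r * h) \<omega>" for r \<omega>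
  define A where "A = (\<Sum>i\<in>S. q ^ c i)"
  define b where "b r = (\<Sum>i\<in>S. \<sigma> * euler_weight q (c i) r)" for r
  define Y where "Y \<omega> = (\<Sum>r<N. b r * D r \<omega>)" for \<omega>
  have Wm: "\<And>t. t \<ge> 0 \<Longrightarrow> random_variable borel (W t)"
    using W by (simp add: standard_brownian_motion_def)
  have Z0m: "random_variable borel (Z 0)" and indW: "indep_of_process (Z 0) W"
    and Z0: "distributed M lborel (Z 0) (normal_density 0 (sqrt (\<sigma>\<^sup>2 / (2 * \<gamma>))))"
    using Z by (auto simp: stationary_OU_def)
  have times: "0 \<le> real r * h" "real r * h < real (Suc r) * h" for r
    using pos by auto
  have Dm: "random_variable borel (D r)" for r
    unfolding D_def using times(1)[of r] times(1)[of "Suc r"] Wm by (intro borel_measurable_diff)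
  have Dd: "distributed M lborel (D r) (normal_density 0 (sqrt h))" for r
  proof -
    have "\<forall>s t. 0 \<le> s \<and> s < t \<longrightarrow>
        distributed M lborel (\<lambda>\<omega>. W t \<omega> - W s \<omega>) (normal_density 0 (sqrt (t - s)))"
      using W by (simp add: standard_brownian_motion_def)
    then have "distributed M lborel (\<lambda>\<omega>. W (real (Suc r) * h) \<omega> - W (real r * h) \<omega>)
        (normal_density 0 (sqrt (real (Suc r) * h - real r * h)))"
      using times[of r] by blast
    moreover have "real (Suc r) * h - real r * h = h" by (simp add: algebra_simps)
    ultimately show ?thesis unfolding D_def by simp
  qed
  have Di: "indep_vars (\<lambda>_. borel) D {..<N}"
  proof -
    have "\<forall>k t. 0 \<le> t 0 \<and> (\<forall>i<k. t i < t (Suc i)) \<longrightarrow>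
        indep_vars (\<lambda>_. borel) (\<lambda>i \<omega>. W (t (Suc i)) \<omega> - W (t i) \<omega>) {..<k}"
      using W by (simp add: standard_brownian_motion_def)
    from this[rule_format, of "\<lambda>r. real r * h" N] show ?thesis
      using times unfolding D_def by simp
  qed
  have X: "(\<Sum>i\<in>S. euler_scheme q \<sigma> (Z 0 \<omega>)
            (\<lambda>j. W (real (Suc j) * h) \<omega> - W (real j * h) \<omega>) (c i)) = A * Z 0 \<omega> + Y \<omega>" for \<omega>
  proof -
    have "euler_scheme q \<sigma> (Z 0 \<omega>) (\<lambda>j. W (real (Suc j) * h) \<omega> - W (real j * h) \<omega>) (c i)
        = q ^ c i * Z 0 \<omega> + (\<Sum>r<N. \<sigma> * euler_weight q (c i) r * D r \<omega>)" if "i \<in> S" for i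
    proof -
      have "(\<Sum>r<c i. \<sigma> * q ^ (c i - Suc r) * D r \<omega>) = (\<Sum>r<N. \<sigma> * euler_weight q (c i) r * D r \<omega>)"
        by (rule sum.mono_neutral_cong_left) (use c[OF that] in \<open>auto simp: euler_weight_def\<close>)
      then show ?thesis unfolding euler_scheme_eq D_def by simp
    qed
    then have "(\<Sum>i\<in>S. euler_scheme q \<sigma> (Z 0 \<omega>)
            (\<lambda>j. W (real (Suc j) * h) \<omega> - W (real j * h) \<omega>) (c i))
        = (\<Sum>i\<in>S. q ^ c i * Z 0 \<omega> + (\<Sum>r<N. \<sigma> * euler_weight q (c i) r * D r \<omega>))"
      by simp
    also have "\<dots> = A * Z 0 \<omega> + Y \<omega>"
      unfolding A_def Y_def b_def sum.distrib sum_distrib_right by (subst sum.swap) simp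
    finally show ?thesis .
  qed
  have ind: "indep_var borel (\<lambda>\<omega>. A * Z 0 \<omega>) borel Y"
  proof -
    let ?F = "vimage_algebra (space M) (\<lambda>\<omega>. \<lambda>t\<in>{0..}. W t \<omega>) (\<Pi>\<^sub>M t\<in>{0::real..}. (borel :: real measure))"
    have Wv: "W t \<in> borel_measurable ?F" if "t \<ge> 0" for t
    proof -
      have "(\<lambda>\<omega>. \<lambda>t\<in>{0..}. W t \<omega>) \<in> measurable ?F (\<Pi>\<^sub>M t\<in>{0..}. borel)"
        by (rule measurable_vimage_algebra1) (auto simp: space_PiM)
      from measurable_compose[OF this measurable_component_singleton[of t]]
      show ?thesis using that by simp
    qed
    have "Y \<in> borel_measurable ?F"
      unfolding Y_def D_def
      by (intro borel_measurable_sum borel_measurable_times borel_measurable_diff borel_measurable_const Wv times(1))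
    from indep_var_of_process[OF indW Z0m _ this] Wm
    have "indep_var borel (Z 0) borel Y" by blast
    then have "indep_var borel ((\<lambda>x. A * x) \<circ> Z 0) borel ((\<lambda>x. x) \<circ> Y)"
      by (rule indep_var_compose) auto
    then show ?thesis unfolding comp_def .
  qed
  have "char (distr M borel Y) t = (\<Prod>r<N. char (distr M borel (\<lambda>\<omega>. b r * D r \<omega>)) t)"
    unfolding Y_def
    by (rule char_distr_sum) (rule indep_vars_compose2[OF Di, where Y="\<lambda>r x. b r * x"], simp)
  also have "\<dots> = (\<Prod>r<N. complex_of_real (exp (- (h * (b r * t)\<^sup>2) / 2)))"
    using pos by (simp add: char_distr_scale Dm char_distr_normal[OF Dd])
  also have "\<dots> = complex_of_real (exp (\<Sum>r<N. - (h * (b r * t)\<^sup>2) / 2))"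
    by (simp add: exp_sum)
  finally have cY: "char (distr M borel Y) t = complex_of_real (exp (\<Sum>r<N. - (h * (b r * t)\<^sup>2) / 2))" .
  have "char (distr M borel (\<lambda>\<omega>. A * Z 0 \<omega>)) t = complex_of_real (exp (- (\<sigma>\<^sup>2 / (2 * \<gamma>) * (A * t)\<^sup>2) / 2))"
    using char_distr_normal[OF Z0, of "A * t"] pos by (simp add: char_distr_scale Z0m)
  then have "char (distr M borel (\<lambda>\<omega>. A * Z 0 \<omega> + Y \<omega>)) t
      = complex_of_real (exp (- (\<sigma>\<^sup>2 / (2 * \<gamma>) * (A * t)\<^sup>2) / 2 + (\<Sum>r<N. - (h * (b r * t)\<^sup>2) / 2)))"
    unfolding char_distr_add[OF ind] cY exp_add by simp
  \<comment> \<open>Both squared coefficients are now expanded into double sums over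
    \<open>S\<close>, so that the limit can be taken separately for each pair of indices.\<close>
  also have "- (\<sigma>\<^sup>2 / (2 * \<gamma>) * (A * t)\<^sup>2) / 2 + (\<Sum>r<N. - (h * (b r * t)\<^sup>2) / 2)
      = - ((A\<^sup>2 * (\<sigma>\<^sup>2 / (2 * \<gamma>)) + h * (\<Sum>r<N. (b r)\<^sup>2)) * t\<^sup>2) / 2"
    by (simp add: sum_distrib_left sum_distrib_right sum_negf field_simps power_mult_distrib flip: sum_divide_distrib)
  also have "A\<^sup>2 * (\<sigma>\<^sup>2 / (2 * \<gamma>)) = (\<Sum>i\<in>S. \<Sum>j\<in>S. q ^ c i * q ^ c j * (\<sigma>\<^sup>2 / (2 * \<gamma>)))"
    by (simp only: A_def power2_eq_square[of "sum _ _"] sum_product) (simp only: sum_distrib_right)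
  also have "h * (\<Sum>r<N. (b r)\<^sup>2) = h * (\<Sum>r<N. \<Sum>i\<in>S. \<Sum>j\<in>S. \<sigma>\<^sup>2 * (euler_weight q (c i) r * euler_weight q (c j) r))"
    by (simp only: b_def power2_eq_square sum_product) (simp only: mult_ac)
  also have "\<dots> = (\<Sum>i\<in>S. \<Sum>j\<in>S. \<sigma>\<^sup>2 * h * (\<Sum>r<N. euler_weight q (c i) r * euler_weight q (c j) r))"
  proof -
    have "(\<Sum>r<N. \<Sum>i\<in>S. \<Sum>j\<in>S. \<sigma>\<^sup>2 * (euler_weight q (c i) r * euler_weight q (c j) r))
        = (\<Sum>i\<in>S. \<Sum>r<N. \<Sum>j\<in>S. \<sigma>\<^sup>2 * (euler_weight q (c i) r * euler_weight q (c j) r))"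
      by (rule sum.swap)
    also have "\<dots> = (\<Sum>i\<in>S. \<Sum>j\<in>S. \<Sum>r<N. \<sigma>\<^sup>2 * (euler_weight q (c i) r * euler_weight q (c j) r))"
      by (rule sum.cong[OF refl], rule sum.swap)
    finally show ?thesis by (simp only: sum_distrib_left mult_ac)
  qed
  finally show ?thesis unfolding X sum.distrib .
qed

text \<open>The characteristic functions of the Euler sums have two limits: that of the sampled sum,
  by pathwise convergence, and a Gaussian one, by convergence of the covariances. The set
  \<open>S\<close> is nonempty because the empty sum has variance 0 and no density.\<close>

lemma (in prob_space) stationary_OU_sum_normal:
  assumes W: "standard_brownian_motion W" and Z: "stationary_OU \<gamma> \<sigma> W Z"
    and pos: "\<gamma> > 0" "\<sigma> > 0" "\<tau> > 0" and S: "finite S" "S \<noteq> {}"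
  shows "distributed M lborel (\<lambda>\<omega>. \<Sum>i\<in>S. Z (real i * \<tau>) \<omega>)
     (normal_density 0 (sqrt (\<Sum>i\<in>S. \<Sum>j\<in>S. \<sigma>\<^sup>2 / (2 * \<gamma>) * exp (- (\<gamma> * \<tau> * \<bar>real i - real j\<bar>)))))"
    (is "distributed M lborel ?X (normal_density 0 (sqrt ?v))")
proof (rule distributed_normal_of_char)
  have Zm: "\<And>t. t \<ge> 0 \<Longrightarrow> random_variable borel (Z t)"
    using Z by (simp add: stationary_OU_def)
  then show Xm: "random_variable borel ?X"
    using pos by (intro borel_measurable_sum) simp
  show "?v > 0"
    using S pos by (intro sum_pos) auto
  fix t
  obtain N where N: "\<And>i. i \<in> S \<Longrightarrow> i \<le> N" using S(1) finite_nat_set_iff_bounded_le by auto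
  define h where "h m = \<tau> / real (Suc m)" for m
  have h: "h m > 0" for m using pos by (simp add: h_def)
  define E where "E m \<omega> = (\<Sum>i\<in>S. euler_scheme (1 - \<gamma> * h m) \<sigma> (Z 0 \<omega>)
            (\<lambda>j. W (real (Suc j) * h m) \<omega> - W (real j * h m) \<omega>) (i * Suc m))" for m \<omega>
  have Wm: "\<And>t. t \<ge> 0 \<Longrightarrow> random_variable borel (W t)"
    using W by (simp add: standard_brownian_motion_def)
  have "AE \<omega> in M. continuous_on {0..} (\<lambda>t. Z t \<omega>)"
    and "AE \<omega> in M. \<forall>t\<ge>0. Z t \<omega> = Z 0 \<omega> - \<gamma> * (LINT s:{0..t}|lborel. Z s \<omega>) + \<sigma> * (W t \<omega> - W 0 \<omega>)"
    using Z by (auto simp: stationary_OU_def)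
  then have lim: "AE \<omega> in M. (\<lambda>m. E m \<omega>) \<longlonglongrightarrow> ?X \<omega>"
  proof eventually_elim
    case (elim \<omega>)
    show ?case unfolding E_def h_def
      by (intro tendsto_sum)
        (rule euler_scheme_tendsto[where z="\<lambda>t. Z t \<omega>" and w="\<lambda>t. W t \<omega>",
            OF elim(1) elim(2)[rule_format] pos(3,1)])
  qed
  have Em: "random_variable borel (E m)" for m
    unfolding E_def euler_scheme_eq using h[of m] Wm Zm
    by (intro borel_measurable_sum borel_measurable_add borel_measurable_times borel_measurable_diff
        borel_measurable_const) simp_all
  have "(\<lambda>m. char (distr M borel (E m)) t) \<longlonglongrightarrow> char (distr M borel ?X) t"
    by (rule char_distr_limit[OF Em Xm lim])
  moreover have "(\<lambda>m. char (distr M borel (E m)) t) \<longlonglongrightarrow> complex_of_real (exp (- (?v * t\<^sup>2) / 2))"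
  proof -
    have eq: "char (distr M borel (E m)) t = complex_of_real (exp (- ((\<Sum>i\<in>S. \<Sum>j\<in>S.
         (1 - \<gamma> * h m) ^ (i * Suc m) * (1 - \<gamma> * h m) ^ (j * Suc m) * (\<sigma>\<^sup>2 / (2 * \<gamma>))
             + \<sigma>\<^sup>2 * h m * (\<Sum>r<N * Suc m. euler_weight (1 - \<gamma> * h m) (i * Suc m) r
                                           * euler_weight (1 - \<gamma> * h m) (j * Suc m) r)) * t\<^sup>2) / 2))" for m
      unfolding E_def by (rule char_euler_sum[OF W Z pos(1,2) h mult_le_mono1[OF N]])
    show ?thesis unfolding eq unfolding h_def
      by (intro tendsto_of_real tendsto_exp tendsto_divide tendsto_minus tendsto_mult tendsto_const
          tendsto_sum euler_covariance_tendsto[OF pos(1,3)]) (use N in auto)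
  qed
  ultimately show "char (distr M borel ?X) t = complex_of_real (exp (- (?v * t\<^sup>2) / 2))"
    by (rule LIMSEQ_unique)
qed

lemma (in prob_space) growth_process_eq_prod:
  "growth_process \<rho> Y n \<omega> = (\<Prod>i<n. 1 + \<rho> * exp (Y i \<omega> - variance (Y i) / 2))"
  by (induction n) (simp_all add: mult.commute)

text \<open>A subset \<open>S\<close> collects the times at which the second term of the factor is
  chosen. As \<open>c i i = \<sigma>\<^sup>2 / (2 * \<gamma>)\<close>, the subtracted term is
  exactly half the diagonal of the double sum, so only distinct times interact; the diagonal stays
  explicit for the comparison with a full quadratic form.\<close>

lemma (in prob_space) expectation_growth_process:
  assumes W: "standard_brownian_motion W" and Z: "stationary_OU \<gamma> \<sigma> W Z"
    and pos: "\<gamma> > 0" "\<sigma> > 0" "\<tau> > 0"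
  defines "c \<equiv> \<lambda>i j :: nat. \<sigma>\<^sup>2 / (2 * \<gamma>) * exp (- (\<gamma> * \<tau> * \<bar>real i - real j\<bar>))"
  shows "expectation (growth_process \<rho> (\<lambda>i. Z (real i * \<tau>)) n)
    = (\<Sum>S\<in>Pow {..<n}. \<rho> ^ card S * exp ((\<Sum>i\<in>S. \<Sum>j\<in>S. c i j) / 2 - real (card S) * (\<sigma>\<^sup>2 / (2 * \<gamma>)) / 2))"
proof -
  let ?s = "\<sigma>\<^sup>2 / (2 * \<gamma>)"
  have var: "variance (Z (real i * \<tau>)) = ?s" for i
    using normal_distributed_variance[OF _ stationary_OU_sum_normal[OF W Z pos, of "{i}"]] pos by simp
  have E: "has_bochner_integral M (\<lambda>\<omega>. exp (\<Sum>i\<in>S. Z (real i * \<tau>) \<omega>)) (exp ((\<Sum>i\<in>S. \<Sum>j\<in>S. c i j) / 2))"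
    if S: "S \<in> Pow {..<n}" for S
  proof (cases "S = {}")
    case True
    then show ?thesis by (simp add: has_bochner_integral_iff prob_space)
  next
    case False
    have fin: "finite S" using S finite_subset by auto
    have p: "(\<Sum>i\<in>S. \<Sum>j\<in>S. c i j) > 0"
      unfolding c_def using fin False pos by (intro sum_pos) auto
    show ?thesis
      using has_bochner_integral_exp_normal[OF stationary_OU_sum_normal[OF W Z pos fin False]] p
      unfolding c_def by (simp del: real_sqrt_gt_0_iff add: real_sqrt_gt_0_iff)
  qed
  have "growth_process \<rho> (\<lambda>i. Z (real i * \<tau>)) n \<omega>
      = (\<Sum>S\<in>Pow {..<n}. \<rho> ^ card S * exp (- real (card S) * ?s / 2) * exp (\<Sum>i\<in>S. Z (real i * \<tau>) \<omega>))" for \<omega>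
  proof -
    have "growth_process \<rho> (\<lambda>i. Z (real i * \<tau>)) n \<omega>
        = (\<Prod>i<n. \<rho> * exp (Z (real i * \<tau>) \<omega> - ?s / 2) + 1)"
      unfolding growth_process_eq_prod var by (simp add: add.commute)
    also have "\<dots> = (\<Sum>S\<in>Pow {..<n}. (\<Prod>i\<in>S. \<rho> * exp (Z (real i * \<tau>) \<omega> - ?s / 2)) * (\<Prod>i\<in>{..<n} - S. 1))"
      by (rule prod_add) simp
    also have "\<dots> = (\<Sum>S\<in>Pow {..<n}. \<rho> ^ card S * exp (- real (card S) * ?s / 2) * exp (\<Sum>i\<in>S. Z (real i * \<tau>) \<omega>))"
    proof (rule sum.cong)
      fix S assume "S \<in> Pow {..<n}"
      then have fin: "finite S" using finite_subset by auto
      have "(\<Prod>i\<in>S. \<rho> * exp (Z (real i * \<tau>) \<omega> - ?s / 2)) = \<rho> ^ card S * exp (\<Sum>i\<in>S. Z (real i * \<tau>) \<omega> - ?s / 2)"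
        using fin by (simp add: prod.distrib exp_sum)
      also have "(\<Sum>i\<in>S. Z (real i * \<tau>) \<omega> - ?s / 2) = - real (card S) * ?s / 2 + (\<Sum>i\<in>S. Z (real i * \<tau>) \<omega>)"
        by (simp add: sum_subtractf)
      finally show "(\<Prod>i\<in>S. \<rho> * exp (Z (real i * \<tau>) \<omega> - ?s / 2)) * (\<Prod>i\<in>{..<n} - S. 1)
         = \<rho> ^ card S * exp (- real (card S) * ?s / 2) * exp (\<Sum>i\<in>S. Z (real i * \<tau>) \<omega>)"
        by (simp only: exp_add prod.neutral_const mult_1_right mult.assoc)
    qed simp
    finally show ?thesis .
  qed
  then have "expectation (growth_process \<rho> (\<lambda>i. Z (real i * \<tau>)) n)
      = (\<integral>\<omega>. (\<Sum>S\<in>Pow {..<n}. \<rho> ^ card S * exp (- real (card S) * ?s / 2) * exp (\<Sum>i\<in>S. Z (real i * \<tau>) \<omega>)) \<partial>M)"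
    by (intro Bochner_Integration.integral_cong) auto
  also have "\<dots> = (\<Sum>S\<in>Pow {..<n}. \<rho> ^ card S * exp (- real (card S) * ?s / 2) * exp ((\<Sum>i\<in>S. \<Sum>j\<in>S. c i j) / 2))"
    using E by (subst Bochner_Integration.integral_sum) (auto simp: has_bochner_integral_iff)
  also have "\<dots> = (\<Sum>S\<in>Pow {..<n}. \<rho> ^ card S * exp ((\<Sum>i\<in>S. \<Sum>j\<in>S. c i j) / 2 - real (card S) * ?s / 2))"
    by (intro sum.cong refl) (simp add: mult.assoc flip: exp_add)
  finally show ?thesis .
qed

section \<open>Lattice gas and mean-field functional\<close>

text \<open>Sign convention: a configuration \<open>S\<close> of occupied sites has weight
  \<open>exp\<close> of this quantity, without a minus sign. Each pair is counted twice and the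
  diagonal is included.\<close>

definition gibbs_energy :: "real \<Rightarrow> ('a \<Rightarrow> 'a \<Rightarrow> real) \<Rightarrow> 'a set \<Rightarrow> real" where
  "gibbs_energy \<theta> k S = \<theta> * real (card S) + (\<Sum>i\<in>S. \<Sum>j\<in>S. k i j)"

text \<open>Discrete counterpart of \<open>\<Lambda>\<close>. The diagonal carries
  \<open>p i * p i\<close>, unlike the expected energy under independent occupation, where it
  carries \<open>p i\<close>.\<close>

definition mean_field :: "real \<Rightarrow> ('a \<Rightarrow> 'a \<Rightarrow> real) \<Rightarrow> 'a set \<Rightarrow> ('a \<Rightarrow> real) \<Rightarrow> real" where
  "mean_field \<theta> k A p =
     \<theta> * (\<Sum>i\<in>A. p i) + (\<Sum>i\<in>A. \<Sum>j\<in>A. p i * p j * k i j) - (\<Sum>i\<in>A. entropy_fun (p i))"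

text \<open>The probability that exactly the sites in \<open>S\<close> are occupied when site
  \<open>i\<close> is occupied with probability \<open>p i\<close>, independently of the
  others.\<close>

definition bernoulli_weight :: "('a \<Rightarrow> real) \<Rightarrow> 'a set \<Rightarrow> 'a set \<Rightarrow> real" where
  "bernoulli_weight p A S = (\<Prod>i\<in>S. p i) * (\<Prod>i\<in>A - S. 1 - p i)"

text \<open>The sum is the probability that all of \<open>T\<close> is occupied. In the expansion of
  a product of \<open>p i + x i\<close> with \<open>x i = 0\<close> on \<open>T\<close> and
  \<open>x i = 1 - p i\<close> elsewhere, only the sets \<open>S\<close> containing \<open>T\<close>
  survive. One- and two-point sets \<open>T\<close> give the moments.\<close>

lemma sum_bernoulli_weight_superset:
  assumes A: "finite A" and T: "T \<subseteq> A"
  shows "(\<Sum>S\<in>Pow A. of_bool (T \<subseteq> S) * bernoulli_weight p A S) = (\<Prod>i\<in>T. p i)"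
proof -
  have "(\<Prod>i\<in>T. p i) = (\<Prod>i\<in>A. p i + (if i \<in> T then 0 else 1 - p i))"
    by (rule prod.mono_neutral_cong_left) (use A T in auto)
  also have "\<dots> = (\<Sum>S\<in>Pow A. (\<Prod>i\<in>S. p i) * (\<Prod>i\<in>A - S. if i \<in> T then 0 else 1 - p i))"
    by (rule prod_add[OF A])
  also have "\<dots> = (\<Sum>S\<in>Pow A. of_bool (T \<subseteq> S) * bernoulli_weight p A S)"
  proof (rule sum.cong[OF refl])
    fix S assume S: "S \<in> Pow A"
    have "(\<Prod>i\<in>A - S. if i \<in> T then 0 else 1 - p i) = of_bool (T \<subseteq> S) * (\<Prod>i\<in>A - S. 1 - p i)"
    proof (cases "T \<subseteq> S")
      case True
      then show ?thesis by (auto intro!: prod.cong)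
    next
      case False
      then obtain i where "i \<in> A - S" "i \<in> T" using T by auto
      then show ?thesis using False A by auto
    qed
    then show "(\<Prod>i\<in>S. p i) * (\<Prod>i\<in>A - S. if i \<in> T then 0 else 1 - p i)
        = of_bool (T \<subseteq> S) * bernoulli_weight p A S"
      by (simp add: bernoulli_weight_def)
  qed
  finally show ?thesis by simp
qed

lemma sum_bernoulli_weight:
  assumes "finite A"
  shows "(\<Sum>S\<in>Pow A. bernoulli_weight p A S) = 1"
  using sum_bernoulli_weight_superset[OF assms, of "{}" p] by simp

lemma bernoulli_weight_nonneg:
  assumes "\<And>i. i \<in> A \<Longrightarrow> 0 \<le> p i \<and> p i \<le> 1" and "S \<subseteq> A"
  shows "0 \<le> bernoulli_weight p A S"
  unfolding bernoulli_weight_def using assms by (intro mult_nonneg_nonneg prod_nonneg) auto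

lemma sum_subset_of_bool:
  fixes f :: "'a \<Rightarrow> real"
  assumes "finite A" "S \<subseteq> A"
  shows "(\<Sum>i\<in>S. f i) = (\<Sum>i\<in>A. of_bool (i \<in> S) * f i)"
  by (rule sum.mono_neutral_cong_left) (use assms in auto)

lemma bernoulli_expectation_linear:
  assumes A: "finite A"
  shows "(\<Sum>S\<in>Pow A. bernoulli_weight p A S * (\<Sum>i\<in>S. f i)) = (\<Sum>i\<in>A. p i * f i)"
proof -
  have "(\<Sum>S\<in>Pow A. bernoulli_weight p A S * (\<Sum>i\<in>S. f i))
      = (\<Sum>S\<in>Pow A. \<Sum>i\<in>A. f i * (of_bool ({i} \<subseteq> S) * bernoulli_weight p A S))"
  proof (rule sum.cong[OF refl])
    fix S assume S: "S \<in> Pow A"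
    have "(\<Sum>i\<in>S. f i) = (\<Sum>i\<in>A. of_bool (i \<in> S) * f i)"
      using S by (intro sum_subset_of_bool A) auto
    then show "bernoulli_weight p A S * (\<Sum>i\<in>S. f i)
        = (\<Sum>i\<in>A. f i * (of_bool ({i} \<subseteq> S) * bernoulli_weight p A S))"
      by (simp add: sum_distrib_left mult_ac)
  qed
  also have "\<dots> = (\<Sum>i\<in>A. f i * (\<Sum>S\<in>Pow A. of_bool ({i} \<subseteq> S) * bernoulli_weight p A S))"
    by (subst sum.swap) (simp add: sum_distrib_left)
  also have "\<dots> = (\<Sum>i\<in>A. p i * f i)"
    by (rule sum.cong[OF refl], subst sum_bernoulli_weight_superset[OF A]) auto
  finally show ?thesis .
qed

text \<open>The product runs over the set \<open>{i, j}\<close>, which has one element when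
  \<open>i = j\<close>; the diagonal moment is thus \<open>p i\<close> and not its square.\<close>

lemma bernoulli_expectation_quadratic:
  assumes A: "finite A"
  shows "(\<Sum>S\<in>Pow A. bernoulli_weight p A S * (\<Sum>i\<in>S. \<Sum>j\<in>S. k i j))
       = (\<Sum>i\<in>A. \<Sum>j\<in>A. (\<Prod>x\<in>{i, j}. p x) * k i j)"
proof -
  have "(\<Sum>S\<in>Pow A. bernoulli_weight p A S * (\<Sum>i\<in>S. \<Sum>j\<in>S. k i j))
      = (\<Sum>S\<in>Pow A. \<Sum>i\<in>A. \<Sum>j\<in>A. k i j * (of_bool ({i, j} \<subseteq> S) * bernoulli_weight p A S))"
  proof (rule sum.cong[OF refl])
    fix S assume S: "S \<in> Pow A"
    then have sub: "S \<subseteq> A" by simp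
    have "(\<Sum>i\<in>S. \<Sum>j\<in>S. k i j) = (\<Sum>i\<in>A. of_bool (i \<in> S) * (\<Sum>j\<in>A. of_bool (j \<in> S) * k i j))"
      unfolding sum_subset_of_bool[OF A sub, symmetric] ..
    also have "\<dots> = (\<Sum>i\<in>A. \<Sum>j\<in>A. of_bool ({i, j} \<subseteq> S) * k i j)"
      by (simp add: sum_distrib_left of_bool_conj mult.assoc)
    finally show "bernoulli_weight p A S * (\<Sum>i\<in>S. \<Sum>j\<in>S. k i j)
        = (\<Sum>i\<in>A. \<Sum>j\<in>A. k i j * (of_bool ({i, j} \<subseteq> S) * bernoulli_weight p A S))"
      by (simp add: sum_distrib_left mult_ac)
  qed
  also have "\<dots> = (\<Sum>i\<in>A. \<Sum>S\<in>Pow A. \<Sum>j\<in>A. k i j * (of_bool ({i, j} \<subseteq> S) * bernoulli_weight p A S))"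
    by (rule sum.swap)
  also have "\<dots> = (\<Sum>i\<in>A. \<Sum>j\<in>A. \<Sum>S\<in>Pow A. k i j * (of_bool ({i, j} \<subseteq> S) * bernoulli_weight p A S))"
    by (rule sum.cong[OF refl], rule sum.swap)
  also have "\<dots> = (\<Sum>i\<in>A. \<Sum>j\<in>A. (\<Prod>x\<in>{i, j}. p x) * k i j)"
    by (intro sum.cong refl, subst sum_distrib_left[symmetric], subst sum_bernoulli_weight_superset[OF A])
      (simp_all add: mult.commute)
  finally show ?thesis .
qed

section \<open>Lower and upper bounds for the log-partition function\<close>

text \<open>Nonnegativity of the relative entropy of \<open>\<mu>\<close> with respect to the
  normalised weights, from \<open>ln x \<le> x - 1\<close>. The function \<open>L\<close> has to
  agree with \<open>ln (\<mu> s)\<close> only on the support, so a caller may use an expression that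
  remains additive where \<open>\<mu>\<close> vanishes.\<close>

lemma gibbs_variational_lower:
  fixes w \<mu> L :: "'a \<Rightarrow> real"
  assumes "finite P" "P \<noteq> {}" and w: "\<And>s. s \<in> P \<Longrightarrow> w s > 0"
    and \<mu>: "\<And>s. s \<in> P \<Longrightarrow> \<mu> s \<ge> 0" "(\<Sum>s\<in>P. \<mu> s) = 1"
    and L: "\<And>s. s \<in> P \<Longrightarrow> \<mu> s > 0 \<Longrightarrow> L s = ln (\<mu> s)"
  shows "(\<Sum>s\<in>P. \<mu> s * (ln (w s) - L s)) \<le> ln (\<Sum>s\<in>P. w s)"
proof -
  define Z where "Z = (\<Sum>s\<in>P. w s)"
  have Z: "Z > 0" unfolding Z_def using assms by (intro sum_pos) auto
  have "\<mu> s * (ln (w s) - L s - ln Z) \<le> w s / Z - \<mu> s" if s: "s \<in> P" for s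
  proof (cases "\<mu> s = 0")
    case True
    then show ?thesis using w[OF s] Z by simp
  next
    case False
    then have m: "\<mu> s > 0" using \<mu>(1)[OF s] by simp
    have "ln (w s) - L s - ln Z = ln (w s / (\<mu> s * Z))"
      using m w[OF s] Z L[OF s m] by (simp add: ln_div ln_mult)
    also have "\<dots> \<le> w s / (\<mu> s * Z) - 1"
      using m w[OF s] Z by (intro ln_le_minus_one) simp
    finally have "\<mu> s * (ln (w s) - L s - ln Z) \<le> \<mu> s * (w s / (\<mu> s * Z) - 1)"
      using m by (intro mult_left_mono) auto
    also have "\<dots> = w s / Z - \<mu> s" using m by (simp add: right_diff_distrib)
    finally show ?thesis .
  qed
  then have "(\<Sum>s\<in>P. \<mu> s * (ln (w s) - L s - ln Z)) \<le> (\<Sum>s\<in>P. w s / Z - \<mu> s)"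
    by (rule sum_mono)
  also have "\<dots> = 0"
    using Z \<mu>(2) by (simp add: sum_subtractf Z_def flip: sum_divide_distrib)
  finally have "(\<Sum>s\<in>P. \<mu> s * (ln (w s) - L s)) - (\<Sum>s\<in>P. \<mu> s) * ln Z \<le> 0"
    by (simp add: right_diff_distrib sum_subtractf sum_distrib_right)
  then show ?thesis using \<mu>(2) by (simp add: Z_def)
qed

lemma mean_field_le_log_partition:
  assumes A: "finite A" and k: "\<And>i. i \<in> A \<Longrightarrow> k i i \<ge> 0"
    and p: "\<And>i. i \<in> A \<Longrightarrow> 0 \<le> p i \<and> p i \<le> 1"
  shows "mean_field \<theta> k A p \<le> ln (\<Sum>S\<in>Pow A. exp (gibbs_energy \<theta> k S))"
proof -
  \<comment> \<open>A sum over sites, so its mean follows from the linear moments even if some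
    \<open>p i\<close> is 0 or 1.\<close>
  define L where "L S = (\<Sum>i\<in>S. ln (p i)) + (\<Sum>i\<in>A - S. ln (1 - p i))" for S
  let ?\<mu> = "bernoulli_weight p A"
  have LL: "L S = (\<Sum>i\<in>S. ln (p i)) + ((\<Sum>i\<in>A. ln (1 - p i)) - (\<Sum>i\<in>S. ln (1 - p i)))"
    if "S \<in> Pow A" for S
    using that A by (simp add: L_def sum_diff)
  have "(\<Sum>S\<in>Pow A. ?\<mu> S * (ln (exp (gibbs_energy \<theta> k S)) - L S))
      \<le> ln (\<Sum>S\<in>Pow A. exp (gibbs_energy \<theta> k S))"
  proof (rule gibbs_variational_lower)
    fix S assume S: "S \<in> Pow A" and pos: "?\<mu> S > 0"
    have fin: "finite S" using S A finite_subset by auto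
    have nz: "(\<Prod>i\<in>S. p i) \<noteq> 0" "(\<Prod>i\<in>A - S. 1 - p i) \<noteq> 0"
      using pos by (auto simp: bernoulli_weight_def)
    have a: "p i > 0" if "i \<in> S" for i
      using nz(1) fin p[of i] S that by (metis Pow_iff less_eq_real_def prod_zero_iff subsetD)
    have b: "1 - p i > 0" if "i \<in> A - S" for i
    proof -
      have "1 - p i \<noteq> 0" using nz(2) A that prod_zero_iff[of "A - S" "\<lambda>i. 1 - p i"] by blast
      then show ?thesis using p[of i] that by auto
    qed
    have "(\<Prod>i\<in>S. p i) > 0" "(\<Prod>i\<in>A - S. 1 - p i) > 0"
      using a b by (auto intro!: prod_pos)
    then have "ln (?\<mu> S) = ln (\<Prod>i\<in>S. p i) + ln (\<Prod>i\<in>A - S. 1 - p i)"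
      by (simp add: bernoulli_weight_def ln_mult)
    also have "\<dots> = L S"
    proof -
      have "p i \<noteq> 0" if "i \<in> S" for i using a[OF that] by simp
      moreover have "1 - p i \<noteq> 0" if "i \<in> A - S" for i using b[OF that] by simp
      ultimately show ?thesis unfolding L_def using fin A by (subst (1 2) ln_prod) blast+
    qed
    finally show "L S = ln (?\<mu> S)" ..
  qed (use A sum_bernoulli_weight bernoulli_weight_nonneg[OF p] in auto)
  also have "(\<Sum>S\<in>Pow A. ?\<mu> S * (ln (exp (gibbs_energy \<theta> k S)) - L S))
      = (\<Sum>S\<in>Pow A. ?\<mu> S * (\<Sum>i\<in>S. \<theta>)) + (\<Sum>S\<in>Pow A. ?\<mu> S * (\<Sum>i\<in>S. \<Sum>j\<in>S. k i j))
        - (\<Sum>S\<in>Pow A. ?\<mu> S * (\<Sum>i\<in>S. ln (p i))) - (\<Sum>S\<in>Pow A. ?\<mu> S) * (\<Sum>i\<in>A. ln (1 - p i))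
        + (\<Sum>S\<in>Pow A. ?\<mu> S * (\<Sum>i\<in>S. ln (1 - p i)))"
    unfolding sum_distrib_right sum.distrib[symmetric] sum_subtractf[symmetric]
    by (intro sum.cong refl, subst LL) (auto simp: gibbs_energy_def algebra_simps)
  also have "\<dots> = (\<Sum>i\<in>A. p i * \<theta>) + (\<Sum>i\<in>A. \<Sum>j\<in>A. (\<Prod>x\<in>{i, j}. p x) * k i j)
        - (\<Sum>i\<in>A. p i * ln (p i)) - (\<Sum>i\<in>A. ln (1 - p i)) + (\<Sum>i\<in>A. p i * ln (1 - p i))"
    by (simp only: bernoulli_expectation_linear[OF A] bernoulli_expectation_quadratic[OF A]
        sum_bernoulli_weight[OF A] mult_1)
  also have "\<dots> = \<theta> * (\<Sum>i\<in>A. p i) + (\<Sum>i\<in>A. \<Sum>j\<in>A. (\<Prod>x\<in>{i, j}. p x) * k i j)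
        - (\<Sum>i\<in>A. entropy_fun (p i))"
    by (simp add: entropy_fun_def sum.distrib sum_subtractf sum_distrib_left algebra_simps)
  finally have "\<theta> * (\<Sum>i\<in>A. p i) + (\<Sum>i\<in>A. \<Sum>j\<in>A. (\<Prod>x\<in>{i, j}. p x) * k i j)
        - (\<Sum>i\<in>A. entropy_fun (p i)) \<le> ln (\<Sum>S\<in>Pow A. exp (gibbs_energy \<theta> k S))" .
  \<comment> \<open>On the diagonal \<open>p i\<close> is replaced by its square; a nonnegative
    diagonal of \<open>k\<close> makes this a loss in the right direction.\<close>
  moreover have "(\<Sum>i\<in>A. \<Sum>j\<in>A. p i * p j * k i j) \<le> (\<Sum>i\<in>A. \<Sum>j\<in>A. (\<Prod>x\<in>{i, j}. p x) * k i j)"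
  proof (intro sum_mono)
    fix i j assume ij: "i \<in> A" "j \<in> A"
    show "p i * p j * k i j \<le> (\<Prod>x\<in>{i, j}. p x) * k i j"
    proof (cases "i = j")
      case True
      have "p i * p i \<le> p i" using p[OF ij(1)] by (simp add: mult_left_le)
      then show ?thesis using True k[OF ij(1)] by (auto intro: mult_right_mono)
    qed simp
  qed
  ultimately show ?thesis unfolding mean_field_def by linarith
qed

text \<open>Method of types: configurations are grouped by their block counts, of which there are at
  most \<open>(card A + 1) ^ card C\<close>. Within a group the coarse energy is constant, and the
  block densities serve both as the mean-field trial point and as the Bernoulli parameters that
  bound the size of the group.\<close>

lemma log_partition_le_mean_field:
  fixes b :: "'a \<Rightarrow> 'c" and k :: "'a \<Rightarrow> 'a \<Rightarrow> real" and \<kappa> :: "'c \<Rightarrow> 'c \<Rightarrow> real"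
  assumes A: "finite A" and C: "finite C" and bC: "b ` A \<subseteq> C" and \<delta>: "\<delta> \<ge> 0"
    and coarse: "\<And>i j. i \<in> A \<Longrightarrow> j \<in> A \<Longrightarrow> \<bar>k i j - \<kappa> (b i) (b j)\<bar> \<le> \<delta>"
    and B: "\<And>p. (\<And>i. i \<in> A \<Longrightarrow> 0 \<le> p i \<and> p i \<le> 1) \<Longrightarrow> mean_field \<theta> k A p \<le> B"
  shows "ln (\<Sum>S\<in>Pow A. exp (gibbs_energy \<theta> k S))
           \<le> B + 2 * \<delta> * (real (card A))\<^sup>2 + real (card C) * ln (real (card A) + 1)"
proof -
  define N where "N = real (card A)"
  define m where "m S c = card {i \<in> S. b i = c}" for S c
  \<comment> \<open>Restricting to \<open>C\<close> makes the count vector extensional, so it ranges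
    over the finite set \<open>V\<close>.\<close>
  define cnt where "cnt S = restrict (m S) C" for S
  define V where "V = (\<Pi>\<^sub>E c\<in>C. {..card A})"
  define E where "E = exp (B + 2 * \<delta> * N\<^sup>2)"
  have finV: "finite V" unfolding V_def using C by (intro finite_PiE) auto
  have cV: "cnt S \<in> V" if "S \<in> Pow A" for S
    using that A by (auto simp: cnt_def V_def m_def intro!: card_mono)
  have fibre: "(\<Sum>S\<in>{S \<in> Pow A. cnt S = v}. exp (gibbs_energy \<theta> k S)) \<le> E" for v
  proof -
    define p where "p i = real (v (b i)) / real (m A (b i))" for i
    have av: "v c = m S c" if "S \<in> Pow A" "cnt S = v" "c \<in> C" for S c
      using that by (auto simp: cnt_def)
    \<comment> \<open>A sum over \<open>S\<close> of a function of the block depends on the counts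
      only, and spreading each count evenly over its block turns it into a \<open>p\<close>-weighted
      sum over \<open>A\<close>. This identity yields the size, the coarse energy and the log-weight
      of \<open>S\<close>.\<close>
    have pav: "(\<Sum>i\<in>S. F (b i)) = (\<Sum>i\<in>A. p i * F (b i))"
      if S: "S \<in> Pow A" "cnt S = v" for S and F :: "'c \<Rightarrow> real"
    proof -
      have fS: "finite S" using S A finite_subset by auto
      have "(\<Sum>i\<in>S. F (b i)) = (\<Sum>c\<in>C. \<Sum>i\<in>{i\<in>S. b i = c}. F (b i))"
        using S bC by (intro sum.group[symmetric] fS C) auto
      also have "\<dots> = (\<Sum>c\<in>C. real (m S c) * F c)"
        by (intro sum.cong refl) (simp add: m_def)
      also have "\<dots> = (\<Sum>c\<in>C. \<Sum>i\<in>{i\<in>A. b i = c}. p i * F (b i))"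
      proof (rule sum.cong[OF refl])
        fix c assume c: "c \<in> C"
        have "(\<Sum>i\<in>{i\<in>A. b i = c}. p i * F (b i)) = real (m A c) * (real (v c) / real (m A c) * F c)"
          by (simp add: m_def p_def)
        also have "\<dots> = real (v c) * F c"
        proof (cases "m A c = 0")
          case True
          have "m S c \<le> m A c" unfolding m_def using S A by (intro card_mono) auto
          then show ?thesis using True av[OF S c] by simp
        qed simp
        finally show "real (m S c) * F c = (\<Sum>i\<in>{i\<in>A. b i = c}. p i * F (b i))"
          using av[OF S c] by simp
      qed
      also have "\<dots> = (\<Sum>i\<in>A. p i * F (b i))"
        using bC by (intro sum.group A C)
      finally show ?thesis .
    qed
    show ?thesis
    proof (cases "{S \<in> Pow A. cnt S = v} = {}")
      case True
      then show ?thesis by (simp only: sum.empty) (simp add: E_def)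
    next
      case False
      then obtain S0 where S0: "S0 \<in> Pow A" "cnt S0 = v" by auto
      have p01: "0 \<le> p i \<and> p i \<le> 1" if i: "i \<in> A" for i
      proof -
        have "b i \<in> C" using i bC by auto
        then have "v (b i) = m S0 (b i)" using av[OF S0] by simp
        also have "m S0 (b i) \<le> m A (b i)" unfolding m_def using S0 A by (intro card_mono) auto
        finally show ?thesis by (auto simp: p_def divide_le_eq)
      qed
      \<comment> \<open>Under the block densities all configurations of the fibre have the same weight, so the total
          mass 1 bounds the size of the fibre.\<close>
      have weight: "bernoulli_weight p A S = exp (\<Sum>i\<in>A. entropy_fun (p i))"
        if S: "S \<in> Pow A" "cnt S = v" for S
      proof -
        have fS: "finite S" using S A finite_subset by auto
        have pos: "p i > 0" if i: "i \<in> S" for i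
        proof -
          have bi: "b i \<in> C" using i S bC by auto
          have "m S (b i) > 0" "m A (b i) > 0"
            unfolding m_def using i S fS A by (auto simp: card_gt_0_iff)
          then show ?thesis unfolding p_def av[OF S bi] by simp
        qed
        have lt: "1 - p i > 0" if i: "i \<in> A - S" for i
        proof -
          have bi: "b i \<in> C" using i bC by auto
          have "m S (b i) < m A (b i)"
            unfolding m_def using i S A by (intro psubset_card_mono) auto
          then show ?thesis unfolding p_def av[OF S bi] by (simp add: divide_less_eq)
        qed
        have "bernoulli_weight p A S = exp ((\<Sum>i\<in>S. ln (p i)) + (\<Sum>i\<in>A - S. ln (1 - p i)))"
          using pos lt fS A by (simp add: bernoulli_weight_def exp_add exp_sum)
        also have "(\<Sum>i\<in>A - S. ln (1 - p i)) = (\<Sum>i\<in>A. ln (1 - p i)) - (\<Sum>i\<in>S. ln (1 - p i))"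
          using S A by (simp add: sum_diff)
        also have "(\<Sum>i\<in>S. ln (p i)) = (\<Sum>i\<in>A. p i * ln (p i))"
          using pav[OF S, of "\<lambda>c. ln (real (v c) / real (m A c))"] by (simp add: p_def)
        also have "(\<Sum>i\<in>S. ln (1 - p i)) = (\<Sum>i\<in>A. p i * ln (1 - p i))"
          using pav[OF S, of "\<lambda>c. ln (1 - real (v c) / real (m A c))"] by (simp add: p_def)
        also have "(\<Sum>i\<in>A. p i * ln (p i)) + ((\<Sum>i\<in>A. ln (1 - p i)) - (\<Sum>i\<in>A. p i * ln (1 - p i)))
            = (\<Sum>i\<in>A. entropy_fun (p i))"
          by (simp add: entropy_fun_def left_diff_distrib sum.distrib sum_subtractf)
        finally show ?thesis .
      qed
      have energy: "gibbs_energy \<theta> k S \<le> B + 2 * \<delta> * N\<^sup>2 + (\<Sum>i\<in>A. entropy_fun (p i))"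
        if S: "S \<in> Pow A" "cnt S = v" for S
      proof -
        have fS: "finite S" using S A finite_subset by auto
        have dn: "(\<Sum>i\<in>S. \<Sum>j\<in>S. \<delta>) \<le> \<delta> * N\<^sup>2"
        proof -
          have "real (card S) \<le> N" unfolding N_def using S A by (simp add: card_mono)
          then have "real (card S) * real (card S) \<le> N * N" by (intro mult_mono) (auto simp: N_def)
          then have "\<delta> * (real (card S) * real (card S)) \<le> \<delta> * (N * N)"
            by (rule mult_left_mono) (rule \<delta>)
          then show ?thesis by (simp add: power2_eq_square mult_ac)
        qed
        have "(\<Sum>i\<in>S. \<Sum>j\<in>S. k i j) \<le> (\<Sum>i\<in>S. \<Sum>j\<in>S. \<kappa> (b i) (b j) + \<delta>)"
        proof (intro sum_mono)
          fix i j assume "i \<in> S" "j \<in> S"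
          then have "i \<in> A" "j \<in> A" using S by auto
          from coarse[OF this] show "k i j \<le> \<kappa> (b i) (b j) + \<delta>" by linarith
        qed
        also have "\<dots> \<le> (\<Sum>i\<in>S. \<Sum>j\<in>S. \<kappa> (b i) (b j)) + \<delta> * N\<^sup>2"
          using dn by (simp add: sum.distrib)
        \<comment> \<open>Using \<open>pav\<close> in each variable makes the coarse energy exactly
          bilinear in the densities, diagonal included.\<close>
        also have "(\<Sum>i\<in>S. \<Sum>j\<in>S. \<kappa> (b i) (b j)) = (\<Sum>i\<in>A. \<Sum>j\<in>A. p i * p j * \<kappa> (b i) (b j))"
        proof -
          have "(\<Sum>i\<in>S. \<Sum>j\<in>S. \<kappa> (b i) (b j)) = (\<Sum>i\<in>S. \<Sum>j\<in>A. p j * \<kappa> (b i) (b j))"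
            using pav[OF S] by simp
          also have "\<dots> = (\<Sum>i\<in>A. p i * (\<Sum>j\<in>A. p j * \<kappa> (b i) (b j)))"
            using pav[OF S, of "\<lambda>c. \<Sum>j\<in>A. p j * \<kappa> c (b j)"] by simp
          finally show ?thesis by (simp add: sum_distrib_left mult_ac)
        qed
        \<comment> \<open>Returning from \<open>\<kappa>\<close> to \<open>k\<close> costs
          \<open>\<delta>\<close> per pair a second time, hence the factor 2 in the bound.\<close>
        also have "\<dots> \<le> (\<Sum>i\<in>A. \<Sum>j\<in>A. p i * p j * k i j + \<delta>)"
        proof (intro sum_mono)
          fix i j assume ij: "i \<in> A" "j \<in> A"
          have d: "\<kappa> (b i) (b j) - k i j \<le> \<delta>" "\<delta> \<ge> 0" using coarse[OF ij] by auto
          have "p i * p j \<le> 1" "0 \<le> p i * p j" using p01[OF ij(1)] p01[OF ij(2)]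
            by (auto intro: mult_le_one)
          then have "p i * p j * (\<kappa> (b i) (b j) - k i j) \<le> 1 * \<delta>"
            using d by (meson mult_left_mono mult_right_mono order_trans)
          then show "p i * p j * \<kappa> (b i) (b j) \<le> p i * p j * k i j + \<delta>"
            by (simp add: algebra_simps)
        qed
        also have "\<dots> = (\<Sum>i\<in>A. \<Sum>j\<in>A. p i * p j * k i j) + \<delta> * N\<^sup>2"
          by (simp add: sum.distrib N_def power2_eq_square)
        finally have q: "(\<Sum>i\<in>S. \<Sum>j\<in>S. k i j) \<le> (\<Sum>i\<in>A. \<Sum>j\<in>A. p i * p j * k i j) + 2 * \<delta> * N\<^sup>2"
          by simp
        have "real (card S) = (\<Sum>i\<in>A. p i)" using pav[OF S, of "\<lambda>_. 1"] by simp
        then have "gibbs_energy \<theta> k S \<le> mean_field \<theta> k A p + 2 * \<delta> * N\<^sup>2 + (\<Sum>i\<in>A. entropy_fun (p i))"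
          using q by (simp add: gibbs_energy_def mean_field_def)
        also have "mean_field \<theta> k A p \<le> B" by (rule B) (use p01 in auto)
        finally show ?thesis by simp
      qed
      have "(\<Sum>S\<in>{S \<in> Pow A. cnt S = v}. exp (gibbs_energy \<theta> k S))
          \<le> (\<Sum>S\<in>{S \<in> Pow A. cnt S = v}. E * bernoulli_weight p A S)"
      proof (rule sum_mono)
        fix S assume "S \<in> {S \<in> Pow A. cnt S = v}"
        then have S: "S \<in> Pow A" "cnt S = v" by auto
        show "exp (gibbs_energy \<theta> k S) \<le> E * bernoulli_weight p A S"
          unfolding weight[OF S] E_def using energy[OF S] by (simp flip: exp_add)
      qed
      also have "\<dots> \<le> (\<Sum>S\<in>Pow A. E * bernoulli_weight p A S)"
        using A p01 by (intro sum_mono2) (auto simp: E_def intro!: mult_nonneg_nonneg bernoulli_weight_nonneg)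
      also have "\<dots> = E"
        using sum_bernoulli_weight[OF A, of p] by (simp flip: sum_distrib_left)
      finally show ?thesis .
    qed
  qed
  have "(\<Sum>S\<in>Pow A. exp (gibbs_energy \<theta> k S))
      = (\<Sum>v\<in>V. \<Sum>S\<in>{S \<in> Pow A. cnt S = v}. exp (gibbs_energy \<theta> k S))"
    using A finV cV by (intro sum.group[symmetric]) auto
  also have "\<dots> \<le> (\<Sum>v\<in>V. E)" by (intro sum_mono fibre)
  also have "\<dots> = (N + 1) ^ card C * E"
    using C by (simp add: V_def card_PiE N_def add.commute)
  finally have "ln (\<Sum>S\<in>Pow A. exp (gibbs_energy \<theta> k S)) \<le> ln ((N + 1) ^ card C * E)"
    using A by (subst ln_le_cancel_iff) (auto simp: E_def N_def intro!: sum_pos mult_pos_pos add_nonneg_pos)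
  also have "\<dots> = real (card C) * ln (N + 1) + (B + 2 * \<delta> * N\<^sup>2)"
    by (subst ln_mult) (auto simp: E_def N_def ln_realpow)
  finally show ?thesis unfolding N_def by simp
qed

section \<open>Absolutely continuous functions\<close>

lemma abs_continuous_on_subinterval:
  assumes "abs_continuous_on_interval a b f" "a \<le> c" "d \<le> b"
  shows "abs_continuous_on_interval c d f"
  unfolding abs_continuous_on_interval_def
proof (intro allI impI)
  fix \<epsilon> :: real assume "\<epsilon> > 0"
  then obtain \<delta> where \<delta>: "\<delta> > 0" "\<And>(k::nat) u v. (\<forall>i<k. a \<le> u i \<and> u i \<le> v i \<and> v i \<le> b) \<and>
        disjoint_family_on (\<lambda>i. {u i<..<v i}) {..<k} \<and> (\<Sum>i<k. v i - u i) < \<delta> \<Longrightarrow>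
        (\<Sum>i<k. \<bar>f (v i) - f (u i)\<bar>) < \<epsilon>"
    using assms(1) unfolding abs_continuous_on_interval_def by blast
  show "\<exists>\<delta>>0. \<forall>(k::nat) u v. (\<forall>i<k. c \<le> u i \<and> u i \<le> v i \<and> v i \<le> d) \<and>
        disjoint_family_on (\<lambda>i. {u i<..<v i}) {..<k} \<and> (\<Sum>i<k. v i - u i) < \<delta> \<longrightarrow>
        (\<Sum>i<k. \<bar>f (v i) - f (u i)\<bar>) < \<epsilon>"
  proof (intro exI[of _ \<delta>] conjI allI impI \<delta>(1))
    fix k :: nat and u v
    assume *: "(\<forall>i<k. c \<le> u i \<and> u i \<le> v i \<and> v i \<le> d) \<and>
        disjoint_family_on (\<lambda>i. {u i<..<v i}) {..<k} \<and> (\<Sum>i<k. v i - u i) < \<delta>"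
    then have "\<forall>i<k. a \<le> u i \<and> u i \<le> v i \<and> v i \<le> b" using assms(2,3) by force
    with * show "(\<Sum>i<k. \<bar>f (v i) - f (u i)\<bar>) < \<epsilon>" by (intro \<delta>(2)) blast
  qed
qed

text \<open>The gauge is built directly. At tags outside \<open>N\<close> differentiability makes
  the increment of \<open>g\<close> over a cell nearly linear; cells tagged in \<open>N\<close> are
  forced into an open set of small measure, where absolute continuity bounds the sum of the
  increments. Setting the integrand to 0 on \<open>N\<close> removes those cells from the Riemann
  sum.\<close>

lemma has_integral_derivative_of_abs_continuous:
  fixes g f :: "real \<Rightarrow> real"
  assumes ab: "a \<le> b" and ac: "abs_continuous_on_interval a b g" and N: "negligible N"
    and deriv: "\<And>x. x \<in> {a..b} - N \<Longrightarrow> (g has_real_derivative f x) (at x)"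
  shows "(f has_integral (g b - g a)) {a..b}"
proof -
  define f0 where "f0 x = (if x \<in> N then 0 else f x)" for x
  have "(f0 has_integral (g b - g a)) (cbox a b)"
    unfolding has_integral
  proof (intro allI impI)
    fix e :: real assume e: "e > 0"
    define \<epsilon> where "\<epsilon> = e / (2 * (b - a + 1))"
    have \<epsilon>: "\<epsilon> > 0" using e ab by (simp add: \<epsilon>_def)
    have "\<forall>x\<in>{a..b} - N. \<exists>d>0. \<forall>y. \<bar>y - x\<bar> < d \<longrightarrow> \<bar>g y - g x - f x * (y - x)\<bar> \<le> \<epsilon> * \<bar>y - x\<bar>"
    proof
      fix x assume "x \<in> {a..b} - N"
      from deriv[OF this] show "\<exists>d>0. \<forall>y. \<bar>y - x\<bar> < d \<longrightarrow> \<bar>g y - g x - f x * (y - x)\<bar> \<le> \<epsilon> * \<bar>y - x\<bar>"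
        using \<epsilon> unfolding has_field_derivative_def has_derivative_at_alt by simp
    qed
    then obtain d where d: "\<And>x. x \<in> {a..b} - N \<Longrightarrow> d x > 0"
      "\<And>x y. x \<in> {a..b} - N \<Longrightarrow> \<bar>y - x\<bar> < d x \<Longrightarrow> \<bar>g y - g x - f x * (y - x)\<bar> \<le> \<epsilon> * \<bar>y - x\<bar>"
      by metis
    have e2: "e / 2 > 0" using e by simp
    then obtain \<delta> where \<delta>: "\<delta> > 0" "\<And>(k::nat) u v. (\<forall>i<k. a \<le> u i \<and> u i \<le> v i \<and> v i \<le> b) \<and>
        disjoint_family_on (\<lambda>i. {u i<..<v i}) {..<k} \<and> (\<Sum>i<k. v i - u i) < \<delta> \<Longrightarrow>
        (\<Sum>i<k. \<bar>g (v i) - g (u i)\<bar>) < e / 2"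
      using ac unfolding abs_continuous_on_interval_def by blast
    have Nl: "N \<in> null_sets lebesgue" using N negligible_iff_null_sets by blast
    obtain U where U: "open U" "N \<subseteq> U" "emeasure lebesgue (U - N) < ennreal \<delta>"
      using sets_lebesgue_outer_open[of N \<delta>] Nl \<delta>(1) by blast
    have Ul: "U \<in> sets lebesgue" using U(1) by simp
    have eU: "emeasure lebesgue U < ennreal \<delta>"
      using U(3) emeasure_Diff_null_set[OF Nl Ul] by simp
    have "\<forall>x\<in>N. \<exists>r>0. ball x r \<subseteq> U" using U(1,2) by (meson openE subsetD)
    then obtain r where r: "\<And>x. x \<in> N \<Longrightarrow> r x > 0" "\<And>x. x \<in> N \<Longrightarrow> ball x (r x) \<subseteq> U" by metis
    define \<rho> where "\<rho> x = (if x \<in> N then r x else if x \<in> {a..b} then d x else 1)" for x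
    define G where "G x = ball x (\<rho> x)" for x
    have \<rho>: "\<rho> x > 0" for x using r d by (auto simp: \<rho>_def)
    show "\<exists>\<gamma>. gauge \<gamma> \<and> (\<forall>D. D tagged_division_of cbox a b \<and> \<gamma> fine D \<longrightarrow>
       norm ((\<Sum>(x, k)\<in>D. measure lborel k *\<^sub>R f0 x) - (g b - g a)) < e)"
    proof (intro exI conjI allI impI; (elim conjE)?)
      show "gauge G" unfolding G_def using \<rho> by (intro gauge_ball_dependent) auto
      fix D assume D: "D tagged_division_of cbox a b" and fine: "G fine D"
      have finD: "finite D" using D by blast
      define T where "T = (\<lambda>(x::real, K). measure lborel K * f0 x - (g (Sup K) - g (Inf K)))"
      define D1 where "D1 = {z \<in> D. fst z \<in> N}"
      define D2 where "D2 = {z \<in> D. fst z \<notin> N}"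
      have D12: "D = D1 \<union> D2" "D1 \<inter> D2 = {}" "finite D1" "finite D2"
        using finD by (auto simp: D1_def D2_def)
      have cell: "\<exists>u v. K = {u..v} \<and> u \<le> v \<and> a \<le> u \<and> v \<le> b \<and> x \<in> {u..v} \<and> Inf K = u \<and> Sup K = v
          \<and> measure lborel K = v - u \<and> {u..v} \<subseteq> G x" if "(x, K) \<in> D" for x K
      proof -
        obtain u v where K: "K = cbox u v" using tagged_division_ofD(4)[OF D \<open>(x, K) \<in> D\<close>] by auto
        have x: "x \<in> {u..v}" using tagged_division_ofD(2)[OF D that] K by simp
        have "{u..v} \<subseteq> {a..b}" using tagged_division_ofD(3)[OF D that] K by simp
        moreover have "{u..v} \<subseteq> G x" using fineD[OF fine that] K by simp
        ultimately show ?thesis using x K by (intro exI[of _ u] exI[of _ v]) auto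
      qed
      have "(\<Sum>(x, k)\<in>D. measure lborel k *\<^sub>R f0 x) - (g b - g a) = (\<Sum>z\<in>D. T z)"
        using additive_tagged_division_1[of a b D g] ab D
        by (simp add: T_def split_def sum_subtractf)
      also have "\<dots> = (\<Sum>z\<in>D1. T z) + (\<Sum>z\<in>D2. T z)"
        unfolding D12(1) using D12 by (intro sum.union_disjoint) auto
      finally have split: "(\<Sum>(x, k)\<in>D. measure lborel k *\<^sub>R f0 x) - (g b - g a) = (\<Sum>z\<in>D1. T z) + (\<Sum>z\<in>D2. T z)" .
      have "\<bar>\<Sum>z\<in>D2. T z\<bar> \<le> (\<Sum>z\<in>D2. \<epsilon> * (Sup (snd z) - Inf (snd z)))"
      proof (rule order_trans[OF sum_abs], rule sum_mono)
        fix z assume z: "z \<in> D2"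
        obtain x K where zx: "z = (x, K)" by (cases z)
        have xK: "(x, K) \<in> D" "x \<notin> N" using z zx by (auto simp: D2_def)
        obtain u v where uv: "K = {u..v}" "u \<le> v" "a \<le> u" "v \<le> b" "x \<in> {u..v}" "Inf K = u" "Sup K = v"
          "measure lborel K = v - u" "{u..v} \<subseteq> G x" using cell[OF xK(1)] by blast
        have x: "x \<in> {a..b} - N" using uv xK by auto
        then have "\<rho> x = d x" by (simp add: \<rho>_def)
        then have "{u..v} \<subseteq> ball x (d x)" using uv(9) by (simp add: G_def)
        then have "u \<in> ball x (d x)" "v \<in> ball x (d x)" using uv(2) by auto
        then have "\<bar>u - x\<bar> < d x" "\<bar>v - x\<bar> < d x" by (simp_all add: dist_real_def abs_minus_commute)
        from d(2)[OF x this(1)] d(2)[OF x this(2)]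
        have "\<bar>g u - g x - f x * (u - x)\<bar> \<le> \<epsilon> * (x - u)" "\<bar>g v - g x - f x * (v - x)\<bar> \<le> \<epsilon> * (v - x)"
          using uv(5) by auto
        \<comment> \<open>The tag lies between \<open>u\<close> and \<open>v\<close>, so the errors
          on its two sides add up to \<open>\<epsilon> * (v - u)\<close>.\<close>
        then have "\<bar>(v - u) * f x - (g v - g u)\<bar> \<le> \<epsilon> * (x - u) + \<epsilon> * (v - x)"
          by (simp add: algebra_simps abs_le_iff)
        then show "\<bar>T z\<bar> \<le> \<epsilon> * (Sup (snd z) - Inf (snd z))"
          using xK uv by (simp add: T_def zx f0_def algebra_simps)
      qed
      also have "\<dots> \<le> (\<Sum>z\<in>D. \<epsilon> * (Sup (snd z) - Inf (snd z)))"
      proof (rule sum_mono2[OF finD])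
        show "D2 \<subseteq> D" using D12 by auto
        fix z assume "z \<in> D - D2"
        then show "0 \<le> \<epsilon> * (Sup (snd z) - Inf (snd z))"
          using cell[of "fst z" "snd z"] \<epsilon> by fastforce
      qed
      also have "\<dots> = \<epsilon> * (b - a)"
        using additive_tagged_division_1[of a b D "\<lambda>x. x"] ab D
        by (simp add: split_def flip: sum_distrib_left)
      also have "\<dots> < e / 2"
      proof -
        have "\<epsilon> * (2 * (b - a + 1)) = e" using ab by (simp add: \<epsilon>_def)
        then have "2 * (\<epsilon> * (b - a)) + 2 * \<epsilon> = e" by (simp add: algebra_simps)
        then show ?thesis using \<epsilon> by linarith
      qed
      finally have S2: "\<bar>\<Sum>z\<in>D2. T z\<bar> < e / 2" .
      \<comment> \<open>The cells tagged in \<open>N\<close> are enumerated to match the indexed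
        families in the definition of absolute continuity.\<close>
      obtain h where h: "bij_betw h {0..<card D1} D1" using ex_bij_betw_nat_finite[OF D12(3)] by blast
      define u where "u i = Inf (snd (h i))" for i
      define v where "v i = Sup (snd (h i))" for i
      have hD: "h i \<in> D1" if "i < card D1" for i using h that by (auto simp: bij_betw_def)
      have hu: "snd (h i) = {u i..v i} \<and> u i \<le> v i \<and> a \<le> u i \<and> v i \<le> b \<and> {u i..v i} \<subseteq> U" if i: "i < card D1" for i
      proof -
        have xK: "(fst (h i), snd (h i)) \<in> D" "fst (h i) \<in> N" using hD[OF i] by (auto simp: D1_def)
        have "G (fst (h i)) \<subseteq> U" using r(2)[OF xK(2)] xK(2) by (simp add: G_def \<rho>_def)
        then show ?thesis using cell[OF xK(1)] unfolding u_def v_def by fastforce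
      qed
      have disj: "disjoint_family_on (\<lambda>i. {u i<..<v i}) {..<card D1}"
        unfolding disjoint_family_on_def
      proof (intro ballI impI)
        fix i j assume ij: "i \<in> {..<card D1}" "j \<in> {..<card D1}" "i \<noteq> j"
        then have "h i \<noteq> h j" using h by (auto simp: bij_betw_def inj_on_def)
        moreover have "h i \<in> D" "h j \<in> D" using hD ij by (auto simp: D1_def)
        ultimately have "interior (snd (h i)) \<inter> interior (snd (h j)) = {}"
          using tagged_division_ofD(5)[OF D, of "fst (h i)" "snd (h i)" "fst (h j)" "snd (h j)"]
          by (simp add: prod_eq_iff)
        then show "{u i<..<v i} \<inter> {u j<..<v j} = {}"
          using hu[of i] hu[of j] ij by (simp add: interior_atLeastAtMost_real)
      qed
      have "(\<Sum>i<card D1. v i - u i) = (\<Sum>i<card D1. measure lebesgue {u i<..<v i})"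
        using hu by (intro sum.cong) auto
      also have "\<dots> = measure lebesgue (\<Union>i<card D1. {u i<..<v i})"
        using disj hu by (intro measure_finite_Union[symmetric]) (auto simp: emeasure_lborel_Ioo)
      also have "\<dots> \<le> measure lebesgue U"
      proof (rule measure_mono_fmeasurable)
        show "(\<Union>i<card D1. {u i<..<v i}) \<subseteq> U" using hu by fastforce
        show "U \<in> lmeasurable" using eU Ul by (intro fmeasurableI) (auto intro: less_trans)
      qed simp
      also have "\<dots> < \<delta>"
        using eU \<delta>(1) by (simp add: measure_def) (metis enn2real_less_iff ennreal_less_top less_trans)
      finally have "(\<Sum>i<card D1. \<bar>g (v i) - g (u i)\<bar>) < e / 2"
        using hu disj by (intro \<delta>(2)) auto
      also have "(\<Sum>i<card D1. \<bar>g (v i) - g (u i)\<bar>) = (\<Sum>z\<in>D1. \<bar>g (Sup (snd z)) - g (Inf (snd z))\<bar>)"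
        using sum.reindex_bij_betw[OF h, of "\<lambda>z. \<bar>g (Sup (snd z)) - g (Inf (snd z))\<bar>"]
        by (simp add: u_def v_def atLeast0LessThan)
      also have "\<dots> = (\<Sum>z\<in>D1. \<bar>T z\<bar>)"
        by (intro sum.cong refl) (auto simp: T_def D1_def f0_def)
      finally have S1: "(\<Sum>z\<in>D1. \<bar>T z\<bar>) < e / 2" .
      have "\<bar>\<Sum>z\<in>D1. T z\<bar> < e / 2" using S1 sum_abs[of T D1] by linarith
      then show "norm ((\<Sum>(x, k)\<in>D. measure lborel k *\<^sub>R f0 x) - (g b - g a)) < e"
        unfolding split using S2 by simp
    qed
  qed
  then have "(f0 has_integral (g b - g a)) {a..b}" by simp
  then show ?thesis
    by (rule has_integral_spike[OF N, rotated]) (auto simp: f0_def)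
qed

section \<open>Discretization of the variational functional\<close>

lemma exp_neg_lipschitz:
  fixes a s t :: real
  assumes a: "a > 0" and "s \<ge> 0" "t \<ge> 0"
  shows "\<bar>exp (- a * s) - exp (- a * t)\<bar> \<le> a * \<bar>s - t\<bar>"
proof -
  have *: "\<bar>exp (- a * s) - exp (- a * t)\<bar> \<le> a * \<bar>s - t\<bar>" if "0 \<le> s" "s \<le> t" for s t
  proof -
    have "exp (- a * s) - exp (- a * t) = exp (- a * s) * (1 - exp (- (a * (t - s))))"
      by (simp add: right_diff_distrib algebra_simps flip: exp_add)
    also have "\<dots> \<le> 1 * (a * (t - s))"
      using that a exp_ge_add_one_self[of "- (a * (t - s))"] by (intro mult_mono) auto
    finally have "exp (- a * s) - exp (- a * t) \<le> a * (t - s)" by simp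
    moreover have "exp (- a * t) \<le> exp (- a * s)" using that a by simp
    ultimately show ?thesis using that by simp
  qed
  show ?thesis using *[of s t] *[of t s] assms by (cases "s \<le> t") (simp_all add: abs_minus_commute)
qed

text \<open>The Lipschitz constant \<open>a\<close> of the exponential cancels against the prefactor
  \<open>1 / (2 * a)\<close>, so the discretization errors below do not involve
  \<open>a\<close>.\<close>

lemma K_lipschitz:
  assumes a: "a > 0"
  shows "\<bar>K a y z - K a y' z'\<bar> \<le> (\<bar>y - y'\<bar> + \<bar>z - z'\<bar>) / 2"
proof -
  have "\<bar>K a y z - K a y' z'\<bar> = \<bar>exp (- a * \<bar>y - z\<bar>) - exp (- a * \<bar>y' - z'\<bar>)\<bar> / (2 * a)"
    using a by (simp add: K_def diff_divide_distrib[symmetric])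
  also have "\<dots> \<le> (a * \<bar>\<bar>y - z\<bar> - \<bar>y' - z'\<bar>\<bar>) / (2 * a)"
    using a by (intro divide_right_mono exp_neg_lipschitz) auto
  also have "\<dots> = \<bar>\<bar>y - z\<bar> - \<bar>y' - z'\<bar>\<bar> / 2" using a by simp
  also have "\<dots> \<le> (\<bar>y - y'\<bar> + \<bar>z - z'\<bar>) / 2" by (intro divide_right_mono) linarith+
  finally show ?thesis .
qed

lemma K_nonneg: "a > 0 \<Longrightarrow> K a y z \<ge> 0"
  by (simp add: K_def)

lemma K_le: "a > 0 \<Longrightarrow> K a y z \<le> 1 / (2 * a)"
  by (simp add: K_def divide_right_mono)

lemma K_measurable [measurable]: "K a y \<in> borel_measurable borel"
  unfolding K_def by measurable

lemma entropy_fun_measurable [measurable]: "entropy_fun \<in> borel_measurable borel"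
  unfolding entropy_fun_def by measurable

lemma cross_entropy_bound:
  fixes x q :: real
  assumes "0 \<le> x" "0 < q"
  shows "x * ln q - x * ln x \<le> q - x"
proof (cases "x = 0")
  case False
  then have x: "x > 0" using assms by simp
  have "x * ln q - x * ln x = x * ln (q / x)" using x assms by (simp add: ln_div algebra_simps)
  also have "\<dots> \<le> x * (q / x - 1)" using x assms by (intro mult_left_mono ln_le_minus_one) auto
  also have "\<dots> = q - x" using x by (simp add: right_diff_distrib)
  finally show ?thesis .
qed (use assms in simp)

text \<open>As a function of \<open>x\<close> the left side is the tangent line of
  \<open>entropy_fun\<close> at \<open>q\<close>, so this is convexity in a form that can be
  integrated.\<close>

lemma entropy_fun_ge_cross_entropy:
  assumes "0 \<le> x" "x \<le> 1" "0 < q" "q < 1"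
  shows "x * ln q + (1 - x) * ln (1 - q) \<le> entropy_fun x"
  using cross_entropy_bound[of x q] cross_entropy_bound[of "1 - x" "1 - q"] assms
  by (simp add: entropy_fun_def)

lemma abs_entropy_fun_le:
  assumes "0 \<le> x" "x \<le> 1"
  shows "\<bar>entropy_fun x\<bar> \<le> 2"
proof -
  have "x * ln x \<le> 0" if "0 \<le> x" "x \<le> 1" for x :: real
    using that by (cases "x = 0") (auto intro: mult_nonneg_nonpos)
  from this[of x] this[of "1 - x"] cross_entropy_bound[of x 1] cross_entropy_bound[of "1 - x" 1] assms
  show ?thesis by (auto simp: entropy_fun_def)
qed

section \<open>Integrals over the cells of an equipartition\<close>

lemma set_integrable_lebesgue_bounded:
  fixes h :: "real \<Rightarrow> real"
  assumes h: "h \<in> borel_measurable lebesgue" and bd: "\<And>x. x \<in> {u..v} \<Longrightarrow> \<bar>h x\<bar> \<le> C"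
  shows "set_integrable lebesgue {u..v} h"
proof (rule set_integrable_bound)
  show "set_integrable lebesgue {u..v} (\<lambda>_. C)"
    by (rule absolutely_integrable_continuous_real) simp
  show "set_borel_measurable lebesgue {u..v} h"
    unfolding set_borel_measurable_def
    by (intro borel_measurable_scaleR borel_measurable_indicator h) simp
  show "AE x\<in>{u..v} in lebesgue. norm (h x) \<le> norm C" using bd by (force intro!: AE_I2)
qed

text \<open>Meant for integrands \<open>F\<close> built from \<open>deriv g\<close>, whose values at
  exceptional points are arbitrary; completeness of the measure supplies the measurability of
  \<open>F\<close>.\<close>

lemma lebesgue_integral_spike:
  fixes h F :: "real \<Rightarrow> real"
  assumes h: "set_integrable lebesgue {u..v} h" and N: "negligible N"
    and eq: "\<And>x. x \<in> {u..v} - N \<Longrightarrow> F x = h x"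
  shows "(LINT x:{u..v}|lebesgue. F x) = (LINT x:{u..v}|lebesgue. h x)"
proof -
  have F: "set_integrable lebesgue {u..v} F"
    by (rule absolutely_integrable_spike[OF h N eq])
  have "integral {u..v} F = integral {u..v} h"
    by (rule integral_spike[OF N]) (use eq in auto)
  then show ?thesis
    using set_lebesgue_integral_eq_integral(2)[OF F] set_lebesgue_integral_eq_integral(2)[OF h] by simp
qed

lemma lebesgue_integral_equipartition:
  fixes h :: "real \<Rightarrow> real"
  assumes h: "set_integrable lebesgue {0..1} h" and n: "n \<ge> 1"
  shows "(LINT x:{0..1}|lebesgue. h x) = (\<Sum>i<n. LINT x:{real i / real n..real (Suc i) / real n}|lebesgue. h x)"
proof -
  have sub: "set_integrable lebesgue {u..v} h" if "0 \<le> u" "v \<le> 1" for u v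
    by (rule set_integrable_subset[OF h]) (use that in auto)
  have "(LINT x:{0..real m / real n}|lebesgue. h x)
      = (\<Sum>i<m. LINT x:{real i / real n..real (Suc i) / real n}|lebesgue. h x)" if "m \<le> n" for m
    using that
  proof (induction m)
    case 0
    show ?case using sub[of 0 0] by (simp add: set_lebesgue_integral_eq_integral)
  next
    case (Suc m)
    have le: "0 \<le> real m / real n" "real m / real n \<le> real (Suc m) / real n" "real (Suc m) / real n \<le> 1"
      using Suc.prems n by (auto simp: divide_right_mono)
    have i: "set_integrable lebesgue {0..real (Suc m) / real n} h"
      "set_integrable lebesgue {0..real m / real n} h"
      "set_integrable lebesgue {real m / real n..real (Suc m) / real n} h"
      using le by (auto intro!: sub simp del: of_nat_Suc)
    have "integral {0..real m / real n} h + integral {real m / real n..real (Suc m) / real n} h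
        = integral {0..real (Suc m) / real n} h"
      using le i(1) by (intro Henstock_Kurzweil_Integration.integral_combine set_lebesgue_integral_eq_integral)
    then show ?case
      using Suc.IH Suc.prems i by (simp add: set_lebesgue_integral_eq_integral del: of_nat_Suc)
  qed
  from this[of n] n show ?thesis by simp
qed

lemma set_integral_near_const:
  fixes f h :: "real \<Rightarrow> real"
  assumes f: "f \<in> borel_measurable lebesgue" "\<And>x. 0 \<le> f x \<and> f x \<le> 1"
    and h: "h \<in> borel_measurable lebesgue" and near: "\<And>x. x \<in> {u..v} \<Longrightarrow> \<bar>h x - q\<bar> \<le> \<epsilon>"
  shows "set_integrable lebesgue {u..v} (\<lambda>x. f x * h x)"
    and "\<bar>(LINT x:{u..v}|lebesgue. f x * h x) - q * (LINT x:{u..v}|lebesgue. f x)\<bar>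
           \<le> \<epsilon> * (LINT x:{u..v}|lebesgue. f x)"
proof -
  have fi: "set_integrable lebesgue {u..v} f"
    by (rule set_integrable_lebesgue_bounded[where C=1]) (use f in auto)
  have hb: "\<bar>f x * h x\<bar> \<le> \<bar>q\<bar> + \<epsilon>" if "x \<in> {u..v}" for x
  proof -
    have "\<bar>f x * h x\<bar> \<le> 1 * \<bar>h x\<bar>" using f(2)[of x] by (simp add: abs_mult mult_left_le_one_le)
    also have "\<dots> \<le> \<bar>q\<bar> + \<epsilon>" using near[OF that] by linarith
    finally show ?thesis .
  qed
  show fh: "set_integrable lebesgue {u..v} (\<lambda>x. f x * h x)"
    by (rule set_integrable_lebesgue_bounded[where C="\<bar>q\<bar> + \<epsilon>"]) (use f h hb in auto)
  have mi: "set_integrable lebesgue {u..v} (\<lambda>x. c * f x)" for c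
    using fi by simp
  have "f x * h x \<le> (q + \<epsilon>) * f x" "(q - \<epsilon>) * f x \<le> f x * h x" if "x \<in> {u..v}" for x
    using near[OF that] f(2)[of x] by (auto simp: mult.commute[of "f x"] intro!: mult_right_mono)
  then have "(LINT x:{u..v}|lebesgue. f x * h x) \<le> (LINT x:{u..v}|lebesgue. (q + \<epsilon>) * f x)"
    "(LINT x:{u..v}|lebesgue. (q - \<epsilon>) * f x) \<le> (LINT x:{u..v}|lebesgue. f x * h x)"
    by (intro set_integral_mono fh mi; simp)+
  then have "(LINT x:{u..v}|lebesgue. f x * h x) \<le> (q + \<epsilon>) * (LINT x:{u..v}|lebesgue. f x)"
    "(q - \<epsilon>) * (LINT x:{u..v}|lebesgue. f x) \<le> (LINT x:{u..v}|lebesgue. f x * h x)"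
    by (simp_all only: set_integral_mult_right)
  then show "\<bar>(LINT x:{u..v}|lebesgue. f x * h x) - q * (LINT x:{u..v}|lebesgue. f x)\<bar>
           \<le> \<epsilon> * (LINT x:{u..v}|lebesgue. f x)"
    by (simp add: abs_le_iff algebra_simps)
qed

lemma set_integral_unit_bounds:
  fixes f :: "real \<Rightarrow> real"
  assumes f: "f \<in> borel_measurable lebesgue" "\<And>x. 0 \<le> f x \<and> f x \<le> 1" and uv: "u \<le> v"
  shows "0 \<le> (LINT x:{u..v}|lebesgue. f x)" and "(LINT x:{u..v}|lebesgue. f x) \<le> v - u"
proof -
  have fi: "set_integrable lebesgue {u..v} f"
    by (rule set_integrable_lebesgue_bounded[where C=1]) (use f in auto)
  have "(LINT x:{u..v}|lebesgue. 0 :: real) \<le> (LINT x:{u..v}|lebesgue. f x)"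
    by (rule set_integral_mono) (use f(2) fi in auto)
  then show "0 \<le> (LINT x:{u..v}|lebesgue. f x)" by simp
  have "(LINT x:{u..v}|lebesgue. f x) \<le> (LINT x:{u..v}|lebesgue. 1 :: real)"
    by (rule set_integral_mono[OF fi set_integrable_lebesgue_bounded[where C=1]]) (use f(2) in auto)
  then show "(LINT x:{u..v}|lebesgue. f x) \<le> v - u" using uv by (simp add: set_integral_const)
qed

text \<open>This is \<open>\<Lambda>\<close> as a function of the density in place of
  \<open>deriv g\<close>, with \<open>f y\<close> pulled out of the inner integral so that the
  smeared kernel can be treated as a function of \<open>y\<close>.\<close>

definition density_functional :: "real \<Rightarrow> real \<Rightarrow> real \<Rightarrow> (real \<Rightarrow> real) \<Rightarrow> real" where
  "density_functional \<rho> \<beta> a f =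
     ln \<rho> * (LINT x:{0..1}|lebesgue. f x)
     + \<beta> * (LINT y:{0..1}|lebesgue. f y * (LINT z:{0..1}|lebesgue. f z * K a y z))
     - (LINT x:{0..1}|lebesgue. entropy_fun (f x))"

lemma smeared_kernel_lipschitz:
  assumes f: "f \<in> borel_measurable lebesgue" "\<And>x. 0 \<le> f x \<and> f x \<le> 1" and a: "a > 0"
  shows "\<bar>(LINT z:{0..1}|lebesgue. f z * K a y z) - (LINT z:{0..1}|lebesgue. f z * K a y' z)\<bar> \<le> \<bar>y - y'\<bar> / 2"
proof -
  have Km: "K a y \<in> borel_measurable lebesgue" for y
    by (rule measurable_completion) simp
  have i: "set_integrable lebesgue {0..1} (\<lambda>z. f z * K a y z)" for y
    by (rule set_integral_near_const(1)[OF f Km, where q=0 and \<epsilon>="1 / (2 * a)"])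
      (use K_nonneg[OF a] K_le[OF a] in auto)
  have f1: "0 \<le> (LINT x:{0..1}|lebesgue. f x)" "(LINT x:{0..1}|lebesgue. f x) \<le> 1"
    using set_integral_unit_bounds[OF f, of 0 1] by auto
  have "(LINT z:{0..1}|lebesgue. f z * K a y z) - (LINT z:{0..1}|lebesgue. f z * K a y' z)
      = (LINT z:{0..1}|lebesgue. f z * (K a y z - K a y' z))"
    by (simp add: right_diff_distrib i)
  moreover have "\<bar>(LINT z:{0..1}|lebesgue. f z * (K a y z - K a y' z)) - 0 * (LINT z:{0..1}|lebesgue. f z)\<bar>
      \<le> \<bar>y - y'\<bar> / 2 * (LINT z:{0..1}|lebesgue. f z)"
  proof (rule set_integral_near_const(2)[OF f])
    show "(\<lambda>z. K a y z - K a y' z) \<in> borel_measurable lebesgue"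
      by (intro borel_measurable_diff Km)
    show "\<bar>K a y z - K a y' z - 0\<bar> \<le> \<bar>y - y'\<bar> / 2" for z
      using K_lipschitz[OF a, of y z y' z] by simp
  qed
  moreover have "\<bar>y - y'\<bar> / 2 * (LINT z:{0..1}|lebesgue. f z) \<le> \<bar>y - y'\<bar> / 2"
    using f1 by (intro mult_right_le_one_le) auto
  ultimately show ?thesis by simp
qed

text \<open>Measurability in \<open>y\<close> comes from Lipschitz continuity, which the kernel
  passes on to its average.\<close>

lemma smeared_kernel_measurable:
  assumes "f \<in> borel_measurable lebesgue" "\<And>x. 0 \<le> f x \<and> f x \<le> 1" and "a > 0"
  shows "(\<lambda>y. LINT z:{0..1}|lebesgue. f z * K a y z) \<in> borel_measurable lebesgue"
proof -
  have "(1 / 2)-lipschitz_on UNIV (\<lambda>y. LINT z:{0..1}|lebesgue. f z * K a y z)"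
    by (rule lipschitz_onI) (use smeared_kernel_lipschitz[OF assms] in \<open>auto simp: dist_real_def\<close>)
  then have "continuous_on UNIV (\<lambda>y. LINT z:{0..1}|lebesgue. f z * K a y z)"
    by (rule lipschitz_on_continuous_on)
  then have "(\<lambda>y. LINT z:{0..1}|lebesgue. f z * K a y z) \<in> borel_measurable borel"
    by (rule borel_measurable_continuous_onI)
  then show ?thesis by (intro measurable_completion) simp
qed

text \<open>Moving both arguments of \<open>K\<close> to the left endpoints of their cells changes
  it by at most \<open>(1 / n + 1 / n) / 2\<close>. Both are moved at once inside the inner
  integral, which is then within \<open>1 / n\<close> of a constant on each outer cell; the outer
  integration only averages this error.\<close>

lemma quadratic_discretization:
  assumes f: "f \<in> borel_measurable lebesgue" "\<And>x. 0 \<le> f x \<and> f x \<le> 1" and a: "a > 0" and n: "n \<ge> 1"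
    and p: "\<And>i. i < n \<Longrightarrow> (LINT x:{real i / real n..real (Suc i) / real n}|lebesgue. f x) = p i / real n"
  shows "\<bar>(LINT y:{0..1}|lebesgue. f y * (LINT z:{0..1}|lebesgue. f z * K a y z))
          - (\<Sum>i<n. \<Sum>j<n. p i * p j * K a (real i / real n) (real j / real n)) / (real n)\<^sup>2\<bar> \<le> 1 / real n"
proof -
  let ?J = "\<lambda>i. {real i / real n..real (Suc i) / real n}"
  let ?k = "\<lambda>i j. K a (real i / real n) (real j / real n)"
  define c where "c y = (LINT z:{0..1}|lebesgue. f z * K a y z)" for y
  define q where "q i = (\<Sum>j<n. p j / real n * ?k i j)" for i
  have Km: "K a y \<in> borel_measurable lebesgue" for y
    by (rule measurable_completion) simp
  have cm: "c \<in> borel_measurable lebesgue"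
    unfolding c_def by (rule smeared_kernel_measurable[OF f a])
  have fi: "set_integrable lebesgue {0..1} f"
    by (rule set_integrable_lebesgue_bounded[where C=1]) (use f in auto)
  have "(\<Sum>i<n. p i / real n) = (LINT x:{0..1}|lebesgue. f x)"
    unfolding lebesgue_integral_equipartition[OF fi n] using p by simp
  then have sp: "(\<Sum>i<n. p i / real n) \<le> 1"
    using set_integral_unit_bounds(2)[OF f, of 0 1] by simp
  have width: "real (Suc i) / real n - real i / real n = 1 / real n" for i
    by (simp add: diff_divide_distrib[symmetric])
  have near: "\<bar>K a y z - ?k i j\<bar> \<le> 1 / real n" if "y \<in> ?J i" "z \<in> ?J j" for y z i j
    using K_lipschitz[OF a, of y z "real i / real n" "real j / real n"] that width[of i] width[of j] by auto
  \<comment> \<open>Cell errors proportional to the masses \<open>p i / n\<close> add up to one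
    \<open>1 / n\<close>, because the total mass is at most 1.\<close>
  have aux: "\<bar>(\<Sum>i<n. x i) - (\<Sum>i<n. y i)\<bar> \<le> 1 / real n"
    if "\<And>i. i < n \<Longrightarrow> \<bar>x i - y i\<bar> \<le> 1 / real n * (p i / real n)" for x y :: "nat \<Rightarrow> real"
  proof -
    have "\<bar>(\<Sum>i<n. x i) - (\<Sum>i<n. y i)\<bar> \<le> (\<Sum>i<n. \<bar>x i - y i\<bar>)"
      by (simp add: sum_abs flip: sum_subtractf)
    also have "\<dots> \<le> (\<Sum>i<n. 1 / real n * (p i / real n))" using that by (intro sum_mono) auto
    also have "\<dots> = 1 / real n * (\<Sum>i<n. p i / real n)" by (rule sum_distrib_left[symmetric])
    also have "\<dots> \<le> 1 / real n" using sp n by (simp add: divide_right_mono)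
    finally show ?thesis .
  qed
  have cq: "\<bar>c y - q i\<bar> \<le> 1 / real n" if y: "y \<in> ?J i" for y i
  proof -
    have "set_integrable lebesgue {0..1} (\<lambda>z. f z * K a y z)"
      by (rule set_integral_near_const(1)[OF f Km, where q=0 and \<epsilon>="1 / (2 * a)"])
        (use K_nonneg[OF a] K_le[OF a] in auto)
    then have "c y = (\<Sum>j<n. LINT z:?J j|lebesgue. f z * K a y z)"
      unfolding c_def by (rule lebesgue_integral_equipartition[OF _ n])
    moreover have "\<bar>(\<Sum>j<n. LINT z:?J j|lebesgue. f z * K a y z) - (\<Sum>j<n. p j / real n * ?k i j)\<bar> \<le> 1 / real n"
    proof (rule aux)
      fix j assume "j < n"
      moreover have "\<bar>(LINT z:?J j|lebesgue. f z * K a y z) - ?k i j * (LINT z:?J j|lebesgue. f z)\<bar>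
          \<le> 1 / real n * (LINT z:?J j|lebesgue. f z)"
        by (rule set_integral_near_const(2)[OF f Km near[OF y]])
      ultimately show "\<bar>(LINT z:?J j|lebesgue. f z * K a y z) - p j / real n * ?k i j\<bar> \<le> 1 / real n * (p j / real n)"
        using p[of j] by (simp add: mult.commute)
    qed
    ultimately show ?thesis by (simp add: q_def)
  qed
  have cb: "\<bar>c y - c 0\<bar> \<le> 1" if "y \<in> {0..1}" for y
    using smeared_kernel_lipschitz[OF f a, of y 0] that unfolding c_def by auto
  have "set_integrable lebesgue {0..1} (\<lambda>y. f y * c y)"
    by (rule set_integral_near_const(1)[OF f cm cb])
  then have "(LINT y:{0..1}|lebesgue. f y * c y) = (\<Sum>i<n. LINT y:?J i|lebesgue. f y * c y)"
    by (rule lebesgue_integral_equipartition[OF _ n])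
  moreover have "\<bar>(\<Sum>i<n. LINT y:?J i|lebesgue. f y * c y) - (\<Sum>i<n. p i / real n * q i)\<bar> \<le> 1 / real n"
  proof (rule aux)
    fix i assume "i < n"
    moreover have "\<bar>(LINT y:?J i|lebesgue. f y * c y) - q i * (LINT y:?J i|lebesgue. f y)\<bar>
        \<le> 1 / real n * (LINT y:?J i|lebesgue. f y)"
      by (rule set_integral_near_const(2)[OF f cm cq])
    ultimately show "\<bar>(LINT y:?J i|lebesgue. f y * c y) - p i / real n * q i\<bar> \<le> 1 / real n * (p i / real n)"
      using p[of i] by (simp add: mult.commute)
  qed
  moreover have "(\<Sum>i<n. p i / real n * q i)
      = (\<Sum>i<n. \<Sum>j<n. p i * p j * ?k i j) / (real n)\<^sup>2"
    by (simp add: q_def sum_distrib_left sum_divide_distrib power2_eq_square mult_ac)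
  ultimately show ?thesis by (simp add: c_def)
qed

text \<open>Jensen's inequality by integrating the tangent line at \<open>q\<close>. Taking
  \<open>q = p\<close> settles interior values; at \<open>p = 0\<close> and \<open>p = 1\<close> the
  tangent would be vertical and \<open>q\<close> has to approach \<open>p\<close>.\<close>

lemma entropy_integral_ge:
  assumes f: "f \<in> borel_measurable lebesgue" "\<And>x. 0 \<le> f x \<and> f x \<le> 1" and uv: "u < v"
    and p: "(LINT x:{u..v}|lebesgue. f x) = p * (v - u)"
  shows "entropy_fun p * (v - u) \<le> (LINT x:{u..v}|lebesgue. entropy_fun (f x))"
proof -
  let ?E = "LINT x:{u..v}|lebesgue. entropy_fun (f x)"
  have em: "(\<lambda>x. entropy_fun (f x)) \<in> borel_measurable lebesgue"
    using f(1) by measurable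
  have ei: "set_integrable lebesgue {u..v} (\<lambda>x. entropy_fun (f x))"
    by (rule set_integrable_lebesgue_bounded[OF em]) (use f(2) abs_entropy_fun_le in blast)
  have fi: "set_integrable lebesgue {u..v} f"
    by (rule set_integrable_lebesgue_bounded[where C=1]) (use f in auto)
  have ci: "set_integrable lebesgue {u..v} (\<lambda>_. c)" for c :: real
    by (rule absolutely_integrable_continuous_real) simp
  have p01: "0 \<le> p" "p \<le> 1"
    using set_integral_unit_bounds[OF f, of u v] uv unfolding p by (auto simp: zero_le_mult_iff)
  have cross: "(p * ln q + (1 - p) * ln (1 - q)) * (v - u) \<le> ?E" if q: "0 < q" "q < 1" for q
  proof -
    have eq: "f x * ln q + (1 - f x) * ln (1 - q) = ln (1 - q) + (ln q - ln (1 - q)) * f x" for x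
      by (simp add: algebra_simps)
    have i2: "set_integrable lebesgue {u..v} (\<lambda>x. (ln q - ln (1 - q)) * f x)" using fi by simp
    have "(LINT x:{u..v}|lebesgue. f x * ln q + (1 - f x) * ln (1 - q))
        = (LINT x:{u..v}|lebesgue. ln (1 - q)) + (ln q - ln (1 - q)) * (LINT x:{u..v}|lebesgue. f x)"
      unfolding eq set_integral_add(2)[OF ci i2] by simp
    also have "\<dots> = (p * ln q + (1 - p) * ln (1 - q)) * (v - u)"
      using uv by (simp add: p set_integral_const algebra_simps)
    finally have "(p * ln q + (1 - p) * ln (1 - q)) * (v - u)
        = (LINT x:{u..v}|lebesgue. f x * ln q + (1 - f x) * ln (1 - q))" ..
    also have "\<dots> \<le> ?E"
    proof (rule set_integral_mono[OF _ ei])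
      show "set_integrable lebesgue {u..v} (\<lambda>x. f x * ln q + (1 - f x) * ln (1 - q))"
        unfolding eq by (rule set_integral_add(1)[OF ci i2])
      show "f x * ln q + (1 - f x) * ln (1 - q) \<le> entropy_fun (f x)" for x
        using f(2)[of x] q by (intro entropy_fun_ge_cross_entropy) auto
    qed
    finally show ?thesis .
  qed
  show ?thesis
  proof (cases "0 < p \<and> p < 1")
    case True
    then show ?thesis using cross[of p] by (simp add: entropy_fun_def)
  next
    case False
    then have p: "p = 0 \<or> p = 1" using p01 by auto
    have "0 \<le> ?E"
    proof (rule ccontr)
      assume "\<not> 0 \<le> ?E"
      \<comment> \<open>For \<open>p\<close> in \<open>{0, 1}\<close> the cross-entropy bound with \<open>q = 1 - r\<close> or \<open>q = r\<close> gives \<open>ln r * (v - u) \<le> ?E\<close> for all \<open>r < 1\<close>.\<close>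
      define s where "s = exp (?E / (v - u))"
      have s: "0 < s" "s < 1" "ln s * (v - u) = ?E"
        using \<open>\<not> 0 \<le> ?E\<close> uv by (auto simp: s_def divide_neg_pos)
      define r where "r = (1 + s) / 2"
      have r: "0 < r" "r < 1" "s < r" using s by (auto simp: r_def)
      have "ln r * (v - u) \<le> ?E"
        using p cross[of "1 - r"] cross[of r] r by auto
      moreover have "ln s * (v - u) < ln r * (v - u)"
        using r s(1) uv by (intro mult_strict_right_mono) auto
      ultimately show False using s(3) by simp
    qed
    moreover have "entropy_fun p = 0" using p by (auto simp: entropy_fun_def)
    ultimately show ?thesis by simp
  qed
qed

text \<open>The quadratic error \<open>1 / n\<close> is multiplied by \<open>n * \<beta>\<close>,
  hence the constant \<open>\<beta>\<close>. Jensen compares the entropies in one direction only;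
  the reverse bound therefore assumes equality on each cell, as for densities constant on
  cells.\<close>

lemma density_functional_vs_mean_field:
  assumes f: "f \<in> borel_measurable lebesgue" "\<And>x. 0 \<le> f x \<and> f x \<le> 1" and pos: "a > 0" "\<beta> > 0" and n: "n \<ge> 1"
    and p: "\<And>i. i < n \<Longrightarrow> (LINT x:{real i / real n..real (Suc i) / real n}|lebesgue. f x) = p i / real n"
  defines "k \<equiv> \<lambda>i j. \<beta> / real n * K a (real i / real n) (real j / real n)"
  shows "real n * density_functional \<rho> \<beta> a f \<le> mean_field (ln \<rho>) k {..<n} p + \<beta>"
    and "(\<And>i. i < n \<Longrightarrow> (LINT x:{real i / real n..real (Suc i) / real n}|lebesgue. entropy_fun (f x))
              = entropy_fun (p i) / real n) \<Longrightarrow>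
         mean_field (ln \<rho>) k {..<n} p \<le> real n * density_functional \<rho> \<beta> a f + \<beta>"
proof -
  let ?J = "\<lambda>i. {real i / real n..real (Suc i) / real n}"
  define Q where "Q = (LINT y:{0..1}|lebesgue. f y * (LINT z:{0..1}|lebesgue. f z * K a y z))"
  define S where "S = (\<Sum>i<n. \<Sum>j<n. p i * p j * K a (real i / real n) (real j / real n))"
  define E where "E = (LINT x:{0..1}|lebesgue. entropy_fun (f x))"
  have n0: "real n > 0" using n by simp
  have fi: "set_integrable lebesgue {0..1} f"
    by (rule set_integrable_lebesgue_bounded[where C=1]) (use f in auto)
  have em: "(\<lambda>x. entropy_fun (f x)) \<in> borel_measurable lebesgue"
    using f(1) by measurable
  have ei: "set_integrable lebesgue {0..1} (\<lambda>x. entropy_fun (f x))"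
    by (rule set_integrable_lebesgue_bounded[OF em]) (use f(2) abs_entropy_fun_le in blast)
  have lin: "real n * (LINT x:{0..1}|lebesgue. f x) = (\<Sum>i<n. p i)"
    unfolding lebesgue_integral_equipartition[OF fi n] using p n by (simp flip: sum_divide_distrib)
  have width: "real (Suc i) / real n - real i / real n = 1 / real n" for i
    by (simp add: diff_divide_distrib[symmetric])
  have eq: "E = (\<Sum>i<n. LINT x:?J i|lebesgue. entropy_fun (f x))"
    unfolding E_def by (rule lebesgue_integral_equipartition[OF ei n])
  have ge: "(\<Sum>i<n. entropy_fun (p i)) / real n \<le> E"
    unfolding eq sum_divide_distrib
  proof (rule sum_mono)
    fix i assume i: "i \<in> {..<n}"
    have lt: "real i / real n < real (Suc i) / real n" using n0 by (simp add: divide_strict_right_mono)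
    have "(LINT x:?J i|lebesgue. f x) = p i * (real (Suc i) / real n - real i / real n)"
      using p[of i] i unfolding width by simp
    from entropy_integral_ge[OF f lt this]
    show "entropy_fun (p i) / real n \<le> (LINT x:?J i|lebesgue. entropy_fun (f x))"
      unfolding width by simp
  qed
  have D: "real n * density_functional \<rho> \<beta> a f = ln \<rho> * (\<Sum>i<n. p i) + real n * \<beta> * Q - real n * E"
    unfolding lin[symmetric] density_functional_def Q_def E_def by (simp add: algebra_simps)
  have M: "mean_field (ln \<rho>) k {..<n} p = ln \<rho> * (\<Sum>i<n. p i) + \<beta> / real n * S - (\<Sum>i<n. entropy_fun (p i))"
    by (simp add: mean_field_def S_def k_def sum_distrib_left mult_ac)
  have "\<bar>Q - S / (real n)\<^sup>2\<bar> \<le> 1 / real n"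
    unfolding Q_def S_def by (rule quadratic_discretization[OF f pos(1) n p])
  then have "real n * \<beta> * \<bar>Q - S / (real n)\<^sup>2\<bar> \<le> real n * \<beta> * (1 / real n)"
    using n0 pos by (intro mult_left_mono) auto
  then have "\<bar>real n * \<beta> * (Q - S / (real n)\<^sup>2)\<bar> \<le> \<beta>"
    using n0 pos by (simp add: abs_mult)
  moreover have "real n * \<beta> * (Q - S / (real n)\<^sup>2) = real n * \<beta> * Q - \<beta> / real n * S"
    using n0 by (simp add: right_diff_distrib power2_eq_square)
  ultimately have QS: "\<bar>real n * \<beta> * Q - \<beta> / real n * S\<bar> \<le> \<beta>" by simp
  show "real n * density_functional \<rho> \<beta> a f \<le> mean_field (ln \<rho>) k {..<n} p + \<beta>"
    using ge n0 QS unfolding D M by (simp add: divide_le_eq mult.commute abs_le_iff)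
  assume e: "\<And>i. i < n \<Longrightarrow> (LINT x:?J i|lebesgue. entropy_fun (f x)) = entropy_fun (p i) / real n"
  have "real n * E = (\<Sum>i<n. entropy_fun (p i))"
    unfolding eq using e n0 by (simp flip: sum_divide_distrib)
  then show "mean_field (ln \<rho>) k {..<n} p \<le> real n * density_functional \<rho> \<beta> a f + \<beta>"
    using QS unfolding D M by (simp add: abs_le_iff)
qed

section \<open>Admissible functions and the limit\<close>

text \<open>Where \<open>g\<close> is not differentiable, \<open>deriv g\<close> is unspecified. The
  density \<open>f\<close> is \<open>deriv g\<close> reset to 0 at bad points and outside the unit
  interval, which makes it measurable and bounded by 0 and 1 everywhere.\<close>

lemma admissible_density:
  assumes g: "g \<in> \<G>" and a: "a > 0"
  obtains f N where "f \<in> borel_measurable lebesgue" "\<And>x. 0 \<le> f x \<and> f x \<le> 1"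
    "negligible N" "\<And>x. x \<in> {0..1} - N \<Longrightarrow> f x = deriv g x"
    "\<And>u v. 0 \<le> u \<Longrightarrow> u \<le> v \<Longrightarrow> v \<le> 1 \<Longrightarrow> (LINT x:{u..v}|lebesgue. f x) = g v - g u"
    "\<And>\<rho> \<beta>. \<Lambda> \<rho> \<beta> a g = density_functional \<rho> \<beta> a f"
proof -
  have ac: "abs_continuous_on_interval 0 1 g" and g0: "g 0 = 0"
    and ae: "AE x\<in>{0..1} in lborel. g differentiable (at x) \<and> 0 \<le> deriv g x \<and> deriv g x \<le> 1"
    using g by (auto simp: \<G>_def)
  obtain N where N: "N \<in> null_sets lborel"
    and N': "\<And>x. x \<in> space lborel - N \<Longrightarrow> x \<in> {0..1} \<longrightarrow>
      g differentiable (at x) \<and> 0 \<le> deriv g x \<and> deriv g x \<le> 1"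
    by (rule AE_E3[OF ae]) blast
  have good: "g differentiable (at x) \<and> 0 \<le> deriv g x \<and> deriv g x \<le> 1" if "x \<in> {0..1} - N" for x
    using N'[of x] that by simp
  have Nn: "negligible N"
    using N null_sets_completionI[of N lborel] by (simp add: negligible_iff_null_sets)
  define f where "f x = (if x \<in> {0..1} - N then deriv g x else 0)" for x
  have f01: "0 \<le> f x \<and> f x \<le> 1" for x using good[of x] by (auto simp: f_def)
  have fd: "f x = deriv g x" if "x \<in> {0..1} - N" for x using that by (simp add: f_def)
  have hi: "(f has_integral (g v - g u)) {u..v}" if uv: "0 \<le> u" "u \<le> v" "v \<le> 1" for u v
  proof (rule has_integral_derivative_of_abs_continuous[OF uv(2) _ Nn])
    show "abs_continuous_on_interval u v g"
      by (rule abs_continuous_on_subinterval[OF ac]) (use uv in auto)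
    fix x assume "x \<in> {u..v} - N"
    then have x: "x \<in> {0..1} - N" using uv by auto
    then show "(g has_real_derivative f x) (at x)"
      using good[OF x] fd[OF x] DERIV_deriv_iff_real_differentiable by metis
  qed
  have ai: "f absolutely_integrable_on {u..v}" if "0 \<le> u" "u \<le> v" "v \<le> 1" for u v
    using hi[OF that] f01 by (intro nonnegative_absolutely_integrable_1) (auto simp: has_integral_integrable)
  have LI: "(LINT x:{u..v}|lebesgue. f x) = g v - g u" if "0 \<le> u" "u \<le> v" "v \<le> 1" for u v
    using set_lebesgue_integral_eq_integral(2)[OF ai[OF that]] integral_unique[OF hi[OF that]] by simp
  \<comment> \<open>Measurability is read off from integrability over the unit interval, outside of
    which \<open>f\<close> vanishes.\<close>
  have fm: "f \<in> borel_measurable lebesgue"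
  proof -
    have "(\<lambda>x. indicat_real {0..1} x *\<^sub>R f x) \<in> borel_measurable lebesgue"
      using ai[of 0 1] unfolding set_integrable_def by (intro borel_measurable_integrable) simp
    moreover have "(\<lambda>x. indicat_real {0..1} x *\<^sub>R f x) = f"
      by (auto simp: f_def indicator_def)
    ultimately show ?thesis by simp
  qed
  define c where "c y = (LINT z:{0..1}|lebesgue. f z * K a y z)" for y
  have Km: "K a y \<in> borel_measurable lebesgue" for y
    by (rule measurable_completion) simp
  have cm: "c \<in> borel_measurable lebesgue"
    unfolding c_def by (rule smeared_kernel_measurable[OF fm f01 a])
  have fK: "set_integrable lebesgue {0..1} (\<lambda>z. f z * K a y z)" for y
    by (rule set_integral_near_const(1)[OF fm f01 Km, where q=0 and \<epsilon>="1 / (2 * a)"])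
      (use K_nonneg[OF a] K_le[OF a] in auto)
  have inner: "(LINT z:{0..1}|lebesgue. deriv g y * deriv g z * K a y z) = deriv g y * c y" for y
  proof -
    have "(LINT z:{0..1}|lebesgue. deriv g y * deriv g z * K a y z)
        = (LINT z:{0..1}|lebesgue. deriv g y * (f z * K a y z))"
      by (rule lebesgue_integral_spike[OF _ Nn]) (use fK fd in auto)
    then show ?thesis by (simp add: c_def)
  qed
  have cb: "\<bar>c y - c 0\<bar> \<le> 1" if "y \<in> {0..1}" for y
    using smeared_kernel_lipschitz[OF fm f01 a, of y 0] that unfolding c_def by auto
  have outer: "(LINT y:{0..1}|lebesgue. deriv g y * c y) = (LINT y:{0..1}|lebesgue. f y * c y)"
    by (rule lebesgue_integral_spike[OF set_integral_near_const(1)[OF fm f01 cm cb] Nn]) (use fd in auto)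
  have em: "(\<lambda>x. entropy_fun (f x)) \<in> borel_measurable lebesgue"
    using fm by measurable
  have ei: "set_integrable lebesgue {0..1} (\<lambda>x. entropy_fun (f x))"
    by (rule set_integrable_lebesgue_bounded[OF em]) (use f01 abs_entropy_fun_le in blast)
  have ent: "(LINT x:{0..1}|lebesgue. entropy_fun (deriv g x)) = (LINT x:{0..1}|lebesgue. entropy_fun (f x))"
    by (rule lebesgue_integral_spike[OF ei Nn]) (use fd in auto)
  have "\<Lambda> \<rho> \<beta> a g = density_functional \<rho> \<beta> a f" for \<rho> \<beta>
    unfolding \<Lambda>_def density_functional_def inner outer ent using LI[of 0 1] g0 by (simp add: c_def)
  from that[OF fm f01 Nn fd LI this] show ?thesis .
qed

section \<open>Piecewise linear trial functions\<close>

definition ramp :: "real \<Rightarrow> real \<Rightarrow> real \<Rightarrow> real" where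
  "ramp u v x = max 0 (min (v - u) (x - u))"

lemma ramp_lipschitz: "\<bar>ramp u v x - ramp u v y\<bar> \<le> \<bar>x - y\<bar>"
  by (auto simp: ramp_def max_def min_def)

lemma ramp_derivative:
  assumes "u < v" "x \<noteq> u" "x \<noteq> v"
  shows "(ramp u v has_real_derivative of_bool (u < x \<and> x < v)) (at x)"
proof -
  consider "x < u" | "u < x" "x < v" | "v < x" using assms by linarith
  then show ?thesis
  proof cases
    case 1
    have "((\<lambda>_. 0) has_real_derivative 0) (at x)" by simp
    then have "(ramp u v has_real_derivative 0) (at x)"
      by (rule has_field_derivative_transform_within_open[where S="{..<u}"])
        (use 1 assms in \<open>auto simp: ramp_def\<close>)
    then show ?thesis using 1 by simp
  next
    case 2
    have "((\<lambda>x. x - u) has_real_derivative 1) (at x)" by (auto intro!: derivative_eq_intros)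
    then have "(ramp u v has_real_derivative 1) (at x)"
      by (rule has_field_derivative_transform_within_open[where S="{u<..<v}"])
        (use 2 assms in \<open>auto simp: ramp_def\<close>)
    then show ?thesis using 2 by simp
  next
    case 3
    have "((\<lambda>_. v - u) has_real_derivative 0) (at x)" by simp
    then have "(ramp u v has_real_derivative 0) (at x)"
      by (rule has_field_derivative_transform_within_open[where S="{v<..}"])
        (use 3 assms in \<open>auto simp: ramp_def\<close>)
    then show ?thesis using 3 by simp
  qed
qed

lemma lipschitz_imp_abs_continuous:
  assumes L: "L > 0" and g: "\<And>x y. \<bar>g x - g y\<bar> \<le> L * \<bar>x - y\<bar>"
  shows "abs_continuous_on_interval a b g"
  unfolding abs_continuous_on_interval_def
proof (intro allI impI)
  fix \<epsilon> :: real assume \<epsilon>: "\<epsilon> > 0"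
  show "\<exists>\<delta>>0. \<forall>(k::nat) u v. (\<forall>i<k. a \<le> u i \<and> u i \<le> v i \<and> v i \<le> b) \<and>
        disjoint_family_on (\<lambda>i. {u i<..<v i}) {..<k} \<and> (\<Sum>i<k. v i - u i) < \<delta> \<longrightarrow>
        (\<Sum>i<k. \<bar>g (v i) - g (u i)\<bar>) < \<epsilon>"
  proof (intro exI[of _ "\<epsilon> / L"] conjI allI impI; (elim conjE)?)
    show "\<epsilon> / L > 0" using \<epsilon> L by simp
    fix k :: nat and u v
    assume uv: "\<forall>i<k. a \<le> u i \<and> u i \<le> v i \<and> v i \<le> b" and s: "(\<Sum>i<k. v i - u i) < \<epsilon> / L"
    have "(\<Sum>i<k. \<bar>g (v i) - g (u i)\<bar>) \<le> (\<Sum>i<k. L * (v i - u i))"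
    proof (rule sum_mono)
      fix i assume "i \<in> {..<k}"
      then show "\<bar>g (v i) - g (u i)\<bar> \<le> L * (v i - u i)" using g[of "v i" "u i"] uv by simp
    qed
    also have "\<dots> = L * (\<Sum>i<k. v i - u i)" by (rule sum_distrib_left[symmetric])
    also have "\<dots> < \<epsilon>" using s L by (simp add: less_divide_eq mult.commute)
    finally show "(\<Sum>i<k. \<bar>g (v i) - g (u i)\<bar>) < \<epsilon>" .
  qed
qed

lemma piecewise_linear_admissible:
  fixes n :: nat
  assumes n: "n \<ge> 1" and p: "\<And>i. i < n \<Longrightarrow> 0 \<le> p i \<and> p i \<le> 1"
  defines "g \<equiv> \<lambda>x. \<Sum>i<n. p i * ramp (real i / real n) (real (Suc i) / real n) x"
  shows "g \<in> \<G>"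
    and "\<And>i x. i < n \<Longrightarrow> real i / real n < x \<Longrightarrow> x < real (Suc i) / real n \<Longrightarrow> deriv g x = p i"
proof -
  have n0: "real n > 0" using n by simp
  let ?X = "(\<lambda>i. real i / real n) ` {..n}"
  have uv: "real i / real n < real (Suc i) / real n" for i using n0 by (simp add: divide_strict_right_mono)
  have D: "(g has_real_derivative (\<Sum>i<n. p i * of_bool (real i / real n < x \<and> x < real (Suc i) / real n))) (at x)"
    if x: "x \<notin> ?X" for x
    unfolding g_def
  proof (intro DERIV_sum DERIV_cmult ramp_derivative uv)
    fix i assume i: "i \<in> {..<n}"
    then have "real i / real n \<in> ?X" "real (Suc i) / real n \<in> ?X" by (intro imageI; simp)+
    then show "x \<noteq> real i / real n" "x \<noteq> real (Suc i) / real n" using x by metis+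
  qed
  have idx: "i = j" if "real i / real n < x" "x < real (Suc i) / real n"
      "real j / real n < x" "x < real (Suc j) / real n" for i j x
  proof -
    have "real i / real n < real (Suc j) / real n" "real j / real n < real (Suc i) / real n"
      using that by linarith+
    then have "real i < real (Suc j)" "real j < real (Suc i)" using n0 by (simp_all add: divide_less_cancel)
    then show ?thesis by linarith
  qed
  have sel: "(\<Sum>j<n. p j * of_bool (real j / real n < x \<and> x < real (Suc j) / real n)) = p i"
    if i: "i < n" "real i / real n < x" "x < real (Suc i) / real n" for i x
  proof -
    have "(\<Sum>j<n. p j * of_bool (real j / real n < x \<and> x < real (Suc j) / real n))
        = (\<Sum>j<n. if j = i then p j else 0)"
      using i idx by (intro sum.cong) auto
    then show ?thesis using i by simp
  qed
  have nX: "x \<notin> ?X" if i: "real i / real n < x" "x < real (Suc i) / real n" for i x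
  proof
    assume "x \<in> ?X"
    then obtain j where j: "x = real j / real n" by auto
    then have "real i < real j" "real j < real (Suc i)"
      using i n0 by (auto simp: divide_less_cancel simp del: of_nat_Suc)
    then show False by simp
  qed
  show "deriv g x = p i" if "i < n" "real i / real n < x" "x < real (Suc i) / real n" for i x
    using DERIV_imp_deriv[OF D[OF nX[OF that(2,3)]]] sel[OF that] by simp
  \<comment> \<open>The open cells are disjoint, so at most one indicator is 1; at the breakpoints
    the sum is 0.\<close>
  have bound: "0 \<le> (\<Sum>j<n. p j * of_bool (real j / real n < x \<and> x < real (Suc j) / real n)) \<and>
      (\<Sum>j<n. p j * of_bool (real j / real n < x \<and> x < real (Suc j) / real n)) \<le> 1" for x
  proof (cases "\<exists>i<n. real i / real n < x \<and> x < real (Suc i) / real n")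
    case True
    then obtain i where i: "i < n" "real i / real n < x" "x < real (Suc i) / real n" by blast
    show ?thesis unfolding sel[OF i] by (rule p[OF i(1)])
  next
    case False
    then have "(\<Sum>j<n. p j * of_bool (real j / real n < x \<and> x < real (Suc j) / real n)) = 0"
      by (intro sum.neutral) auto
    then show ?thesis by simp
  qed
  have ramp01: "0 \<le> ramp (real i / real n) (real (Suc i) / real n) x"
    "ramp (real i / real n) (real (Suc i) / real n) x \<le> 1 / real n" for i x
    using n0 by (auto simp: ramp_def add_divide_distrib)
  show "g \<in> \<G>"
    unfolding \<G>_def
  proof (intro CollectI conjI)
    show "g \<in> {0..1} \<rightarrow> {0..1}"
    proof
      fix x :: real
      have "0 \<le> g x" unfolding g_def using p ramp01 by (intro sum_nonneg mult_nonneg_nonneg) auto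
      moreover have "g x \<le> (\<Sum>i<n. 1 * (1 / real n))"
        unfolding g_def using p ramp01 by (intro sum_mono mult_mono) auto
      ultimately show "g x \<in> {0..1}" using n0 by simp
    qed
    show "g 0 = 0" unfolding g_def ramp_def using n0 by (intro sum.neutral) auto
    show "abs_continuous_on_interval 0 1 g"
    proof (rule lipschitz_imp_abs_continuous[OF n0])
      fix x y
      have "\<bar>g x - g y\<bar> \<le> (\<Sum>i<n. \<bar>p i * ramp (real i / real n) (real (Suc i) / real n) x
          - p i * ramp (real i / real n) (real (Suc i) / real n) y\<bar>)"
        unfolding g_def by (simp add: sum_abs flip: sum_subtractf)
      also have "\<dots> \<le> (\<Sum>i<n. 1 * \<bar>x - y\<bar>)"
        unfolding right_diff_distrib[symmetric] abs_mult
        using p by (intro sum_mono mult_mono ramp_lipschitz) auto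
      finally show "\<bar>g x - g y\<bar> \<le> real n * \<bar>x - y\<bar>" by simp
    qed
    have "AE x in lborel. x \<notin> ?X"
      by (rule AE_not_in) (intro finite_imp_null_set_lborel, simp)
    then show "AE x\<in>{0..1} in lborel. g differentiable (at x) \<and> 0 \<le> deriv g x \<and> deriv g x \<le> 1"
    proof eventually_elim
      case (elim x)
      have "g differentiable (at x)"
        using D[OF elim] by (auto simp: real_differentiable_def simp del: of_nat_Suc)
      then show ?case unfolding DERIV_imp_deriv[OF D[OF elim]] using bound[of x] by blast
    qed
  qed
qed

section \<open>Transfer between the functional and the lattice gas\<close>

lemma \<Lambda>_le_mean_field:
  assumes g: "g \<in> \<G>" and pos: "a > 0" "\<beta> > 0" and n: "n \<ge> 1"
  obtains p where "\<And>i. i < n \<Longrightarrow> 0 \<le> p i \<and> p i \<le> 1"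
    "real n * \<Lambda> \<rho> \<beta> a g
      \<le> mean_field (ln \<rho>) (\<lambda>i j. \<beta> / real n * K a (real i / real n) (real j / real n)) {..<n} p + \<beta>"
proof -
  obtain f N where f: "f \<in> borel_measurable lebesgue" "\<And>x. 0 \<le> f x \<and> f x \<le> 1"
    and \<Lambda>: "\<And>\<rho> \<beta>. \<Lambda> \<rho> \<beta> a g = density_functional \<rho> \<beta> a f"
    using admissible_density[OF g pos(1)] by metis
  have n0: "real n > 0" using n by simp
  define p where "p i = real n * (LINT x:{real i / real n..real (Suc i) / real n}|lebesgue. f x)" for i
  have width: "real (Suc i) / real n - real i / real n = 1 / real n" for i
    by (simp add: diff_divide_distrib[symmetric])
  have uv: "real i / real n \<le> real (Suc i) / real n" for i using n0 by (simp add: divide_right_mono)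
  show ?thesis
  proof
    show "0 \<le> p i \<and> p i \<le> 1" for i
      using set_integral_unit_bounds[OF f uv, of i] n0 unfolding p_def width
      by (simp add: le_divide_eq mult.commute)
    show "real n * \<Lambda> \<rho> \<beta> a g
      \<le> mean_field (ln \<rho>) (\<lambda>i j. \<beta> / real n * K a (real i / real n) (real j / real n)) {..<n} p + \<beta>"
      unfolding \<Lambda> using n0
      by (intro density_functional_vs_mean_field(1)[OF f pos n]) (simp add: p_def)
  qed
qed

lemma mean_field_le_\<Lambda>:
  assumes pos: "a > 0" "\<beta> > 0" and n: "n \<ge> 1" and p: "\<And>i. i < n \<Longrightarrow> 0 \<le> p i \<and> p i \<le> 1"
  obtains g where "g \<in> \<G>"
    "mean_field (ln \<rho>) (\<lambda>i j. \<beta> / real n * K a (real i / real n) (real j / real n)) {..<n} p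
      \<le> real n * \<Lambda> \<rho> \<beta> a g + \<beta>"
proof -
  have n0: "real n > 0" using n by simp
  define g where "g = (\<lambda>x. \<Sum>i<n. p i * ramp (real i / real n) (real (Suc i) / real n) x)"
  have g: "g \<in> \<G>" and dg: "\<And>i x. i < n \<Longrightarrow> real i / real n < x \<Longrightarrow> x < real (Suc i) / real n \<Longrightarrow> deriv g x = p i"
    unfolding g_def using piecewise_linear_admissible[where p=p, OF n p] by blast+
  obtain f N where f: "f \<in> borel_measurable lebesgue" "\<And>x. 0 \<le> f x \<and> f x \<le> 1"
    and N: "negligible N" and fd: "\<And>x. x \<in> {0..1} - N \<Longrightarrow> f x = deriv g x"
    and \<Lambda>: "\<And>\<rho> \<beta>. \<Lambda> \<rho> \<beta> a g = density_functional \<rho> \<beta> a f"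
    using admissible_density[OF g pos(1)] by metis
  \<comment> \<open>Used with \<open>h\<close> the identity for the cell masses and with
    \<open>entropy_fun\<close> for the equality case of Jensen.\<close>
  have const: "(LINT x:{real i / real n..real (Suc i) / real n}|lebesgue. h (f x)) = h (p i) / real n"
    if i: "i < n" for i and h :: "real \<Rightarrow> real"
  proof -
    let ?N = "N \<union> {real i / real n, real (Suc i) / real n}"
    have N': "negligible ?N" using N by (simp add: negligible_Un)
    have le: "0 \<le> real i / real n" "real (Suc i) / real n \<le> 1"
      using i n0 by auto
    have "(LINT x:{real i / real n..real (Suc i) / real n}|lebesgue. h (f x))
        = (LINT x:{real i / real n..real (Suc i) / real n}|lebesgue. h (p i))"
    proof (rule lebesgue_integral_spike[OF _ N'])
      show "set_integrable lebesgue {real i / real n..real (Suc i) / real n} (\<lambda>_. h (p i))"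
        by (rule absolutely_integrable_continuous_real) simp
      fix x assume x: "x \<in> {real i / real n..real (Suc i) / real n} - ?N"
      then have "real i / real n \<le> x" "x \<le> real (Suc i) / real n" "x \<notin> N"
        by (simp_all del: of_nat_Suc)
      then have "0 \<le> x" "x \<le> 1" using le by linarith+
      then have "x \<in> {0..1} - N" using \<open>x \<notin> N\<close> by simp
      then have "f x = deriv g x" by (rule fd)
      also have "\<dots> = p i" using x by (intro dg[OF i]) auto
      finally show "h (f x) = h (p i)" by simp
    qed
    also have "\<dots> = h (p i) / real n"
      using n0 by (simp add: set_integral_const divide_right_mono diff_divide_distrib[symmetric])
    finally show ?thesis .
  qed
  have "mean_field (ln \<rho>) (\<lambda>i j. \<beta> / real n * K a (real i / real n) (real j / real n)) {..<n} p
      \<le> real n * \<Lambda> \<rho> \<beta> a g + \<beta>"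
    unfolding \<Lambda>
    by (rule density_functional_vs_mean_field(2)[OF f pos n]) (use const[of _ "\<lambda>x. x"] const in auto)
  with g that show ?thesis by blast
qed

lemma \<Lambda>_le_log_partition:
  assumes g: "g \<in> \<G>" and pos: "a > 0" "\<beta> > 0" and n: "n \<ge> 1"
  defines "k \<equiv> \<lambda>i j. \<beta> / real n * K a (real i / real n) (real j / real n)"
  shows "real n * \<Lambda> \<rho> \<beta> a g \<le> ln (\<Sum>S\<in>Pow {..<n}. exp (gibbs_energy (ln \<rho>) k S)) + \<beta>"
proof -
  obtain p where p: "\<And>i. i < n \<Longrightarrow> 0 \<le> p i \<and> p i \<le> 1"
    and le: "real n * \<Lambda> \<rho> \<beta> a g \<le> mean_field (ln \<rho>) k {..<n} p + \<beta>"
    using \<Lambda>_le_mean_field[OF g pos n] unfolding k_def by blast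
  have "mean_field (ln \<rho>) k {..<n} p \<le> ln (\<Sum>S\<in>Pow {..<n}. exp (gibbs_energy (ln \<rho>) k S))"
    by (rule mean_field_le_log_partition) (use p pos K_nonneg in \<open>auto simp: k_def\<close>)
  with le show ?thesis by linarith
qed

text \<open>Blocks have length \<open>l\<close>, and \<open>\<kappa>\<close> is the kernel at their
  left endpoints. The resulting error \<open>\<beta> * l / n^2\<close> per pair is summed twice over
  \<open>n^2\<close> pairs. The block indices run from 0 to \<open>n div l\<close> inclusive, whence
  the \<open>+ 1\<close>.\<close>

lemma log_partition_le_\<Lambda>:
  assumes B: "\<And>g. g \<in> \<G> \<Longrightarrow> \<Lambda> \<rho> \<beta> a g \<le> B" and pos: "a > 0" "\<beta> > 0" and n: "n \<ge> 1" and l: "l \<ge> 1"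
  defines "k \<equiv> \<lambda>i j. \<beta> / real n * K a (real i / real n) (real j / real n)"
  shows "ln (\<Sum>S\<in>Pow {..<n}. exp (gibbs_energy (ln \<rho>) k S))
           \<le> real n * B + \<beta> + 2 * \<beta> * real l + (real n / real l + 1) * ln (real n + 1)"
proof -
  have n0: "real n > 0" using n by simp
  define \<kappa> where "\<kappa> c d = \<beta> / real n * K a (real (c * l) / real n) (real (d * l) / real n)" for c d
  have coarse: "\<bar>k i j - \<kappa> (i div l) (j div l)\<bar> \<le> \<beta> / real n * (real l / real n)" for i j
  proof -
    have near: "\<bar>real i / real n - real (i div l * l) / real n\<bar> \<le> real l / real n" for i
    proof -
      have "real i = real (i div l * l) + real (i mod l)"
        by (simp only: of_nat_add[symmetric] div_mult_mod_eq)
      moreover have "real (i mod l) \<le> real l" using l by (simp add: order_less_imp_le)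
      ultimately have "\<bar>real i - real (i div l * l)\<bar> \<le> real l" by linarith
      then show ?thesis using n0
        unfolding diff_divide_distrib[symmetric] by (simp add: divide_right_mono)
    qed
    have mean: "(x + y) / 2 \<le> c" if "x \<le> c" "y \<le> c" for x y c :: real
      using that by simp
    have "\<bar>k i j - \<kappa> (i div l) (j div l)\<bar> = \<beta> / real n * \<bar>K a (real i / real n) (real j / real n)
        - K a (real (i div l * l) / real n) (real (j div l * l) / real n)\<bar>"
      unfolding k_def \<kappa>_def right_diff_distrib[symmetric] abs_mult using pos n0 by simp
    also have "\<dots> \<le> \<beta> / real n * (real l / real n)"
    proof (rule mult_left_mono)
      show "\<bar>K a (real i / real n) (real j / real n)
          - K a (real (i div l * l) / real n) (real (j div l * l) / real n)\<bar> \<le> real l / real n"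
        by (rule order_trans[OF K_lipschitz[OF pos(1)] mean[OF near near]])
    qed (use pos n0 in simp)
    finally show ?thesis .
  qed
  have "ln (\<Sum>S\<in>Pow {..<n}. exp (gibbs_energy (ln \<rho>) k S))
      \<le> (real n * B + \<beta>) + 2 * (\<beta> / real n * (real l / real n)) * (real (card {..<n}))\<^sup>2
        + real (card {..n div l}) * ln (real (card {..<n}) + 1)"
  proof (rule log_partition_le_mean_field[where b="\<lambda>i. i div l" and \<kappa>=\<kappa>])
    show "(\<lambda>i. i div l) ` {..<n} \<subseteq> {..n div l}" by (auto intro: div_le_mono)
    show "\<bar>k i j - \<kappa> (i div l) (j div l)\<bar> \<le> \<beta> / real n * (real l / real n)" for i j by (rule coarse)
    fix p :: "nat \<Rightarrow> real" assume "\<And>i. i \<in> {..<n} \<Longrightarrow> 0 \<le> p i \<and> p i \<le> 1"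
    then obtain g where "g \<in> \<G>" "mean_field (ln \<rho>) k {..<n} p \<le> real n * \<Lambda> \<rho> \<beta> a g + \<beta>"
      using mean_field_le_\<Lambda>[OF pos n, of p \<rho>] unfolding k_def by blast
    moreover have "real n * \<Lambda> \<rho> \<beta> a g \<le> real n * B" using B[OF \<open>g \<in> \<G>\<close>] by (simp add: mult_left_mono)
    ultimately show "mean_field (ln \<rho>) k {..<n} p \<le> real n * B + \<beta>" by linarith
  qed (use pos n0 in auto)
  also have "2 * (\<beta> / real n * (real l / real n)) * (real (card {..<n}))\<^sup>2 = 2 * \<beta> * real l"
    using n0 by (simp add: power2_eq_square)
  also have "real (card {..n div l}) * ln (real (card {..<n}) + 1) \<le> (real n / real l + 1) * ln (real n + 1)"
    using of_nat_div_le_of_nat[of n l, where ?'a=real] n0 by (auto intro!: mult_right_mono)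
  finally show ?thesis by simp
qed

lemma (in prob_space) log_expectation_growth_bounds:
  assumes \<rho>: "\<rho> > 0" and pos: "a > 0" "\<beta> > 0" and n: "n \<ge> 1"
    and par: "\<sigma> > 0" "\<gamma> > 0" "\<tau> > 0" and \<beta>: "1 / 2 * \<sigma>\<^sup>2 * \<tau> * (real n)\<^sup>2 = \<beta>" and a: "\<gamma> * \<tau> * real n = a"
    and W: "standard_brownian_motion W" and Z: "stationary_OU \<gamma> \<sigma> W Z"
  defines "k \<equiv> \<lambda>i j. \<beta> / real n * K a (real i / real n) (real j / real n)"
  defines "L \<equiv> ln (expectation (growth_process \<rho> (\<lambda>i. Z (real i * \<tau>)) n))"
  defines "P \<equiv> ln (\<Sum>S\<in>Pow {..<n}. exp (gibbs_energy (ln \<rho>) k S))"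
  shows "L \<le> P" and "P - \<beta> / (2 * a) \<le> L"
proof -
  have n0: "real n > 0" using n by simp
  define s where "s = \<sigma>\<^sup>2 / (2 * \<gamma>)"
  have s: "s = \<beta> / (a * real n)"
    unfolding s_def \<beta>[symmetric] a[symmetric] using par n0 by (simp add: field_simps power2_eq_square)
  have s0: "s > 0" using s pos n0 by simp
  have gt: "\<gamma> * \<tau> = a / real n" using a n0 by (simp add: field_simps)
  \<comment> \<open>The two scaling relations enter only through \<open>s\<close> and
    \<open>\<gamma> * \<tau>\<close>; half of \<open>\<beta> / (a * n)\<close> is the prefactor
    \<open>1 / (2 * a)\<close> of \<open>K\<close> times \<open>\<beta> / n\<close>.\<close>
  have ck: "s * exp (- (\<gamma> * \<tau> * \<bar>real i - real j\<bar>)) / 2 = k i j" for i j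
  proof -
    have "\<bar>real i / real n - real j / real n\<bar> = \<bar>real i - real j\<bar> / real n"
      unfolding diff_divide_distrib[symmetric] by simp
    then show ?thesis unfolding k_def K_def s gt by simp
  qed
  have E: "expectation (growth_process \<rho> (\<lambda>i. Z (real i * \<tau>)) n)
      = (\<Sum>S\<in>Pow {..<n}. exp (gibbs_energy (ln \<rho>) k S - real (card S) * s / 2))"
    unfolding expectation_growth_process[OF W Z par(2,1,3)] s_def[symmetric]
  proof (rule sum.cong[OF refl])
    fix S assume "S \<in> Pow {..<n}"
    have "\<rho> ^ card S = exp (ln \<rho> * real (card S))"
      using \<rho> by (simp add: powr_realpow[symmetric] powr_def mult.commute)
    moreover have "(\<Sum>i\<in>S. \<Sum>j\<in>S. s * exp (- (\<gamma> * \<tau> * \<bar>real i - real j\<bar>))) / 2 = (\<Sum>i\<in>S. \<Sum>j\<in>S. k i j)"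
      unfolding ck[symmetric] by (simp add: sum_divide_distrib)
    ultimately show "\<rho> ^ card S * exp ((\<Sum>i\<in>S. \<Sum>j\<in>S. s * exp (- (\<gamma> * \<tau> * \<bar>real i - real j\<bar>))) / 2
        - real (card S) * s / 2) = exp (gibbs_energy (ln \<rho>) k S - real (card S) * s / 2)"
      by (simp add: gibbs_energy_def add_diff_eq flip: exp_add)
  qed
  let ?Z = "\<Sum>S\<in>Pow {..<n}. exp (gibbs_energy (ln \<rho>) k S)"
  let ?E = "\<Sum>S\<in>Pow {..<n}. exp (gibbs_energy (ln \<rho>) k S - real (card S) * s / 2)"
  have Zpos: "?Z > 0" "?E > 0" by (intro sum_pos; auto)+
  have "?E \<le> ?Z" using s0 by (intro sum_mono) simp
  then show "L \<le> P" unfolding L_def P_def E using Zpos by simp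
  have "exp (- (\<beta> / (2 * a))) * ?Z \<le> ?E"
    unfolding sum_distrib_left exp_add[symmetric]
  proof (rule sum_mono)
    fix S assume "S \<in> Pow {..<n}"
    then have "card S \<le> n" using card_mono[of "{..<n}" S] by simp
    then have "real (card S) * s / 2 \<le> real n * s / 2" using s0 by simp
    also have "\<dots> = \<beta> / (2 * a)" unfolding s using n0 by simp
    finally show "exp (- (\<beta> / (2 * a)) + gibbs_energy (ln \<rho>) k S)
        \<le> exp (gibbs_energy (ln \<rho>) k S - real (card S) * s / 2)" by simp
  qed
  then have "ln (exp (- (\<beta> / (2 * a))) * ?Z) \<le> ln ?E" using Zpos by simp
  then show "P - \<beta> / (2 * a) \<le> L" unfolding L_def P_def E using Zpos(1) by (simp add: ln_mult)
qed

theorem theorem1: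
  fixes \<rho> \<beta> a :: real
    and \<sigma> \<gamma> \<tau> :: "nat \<Rightarrow> real"
    and M :: "nat \<Rightarrow> 'w measure"
    and W Z :: "nat \<Rightarrow> real \<Rightarrow> 'w \<Rightarrow> real"
  assumes "\<rho> > 0" and "\<beta> > 0" and "a > 0"
    and "\<And>n. n \<ge> 1 \<Longrightarrow> \<sigma> n > 0 \<and> \<gamma> n > 0 \<and> \<tau> n > 0"
    and "\<And>n. n \<ge> 1 \<Longrightarrow> 1 / 2 * (\<sigma> n)\<^sup>2 * \<tau> n * (real n)\<^sup>2 = \<beta>"
    and "\<And>n. n \<ge> 1 \<Longrightarrow> \<gamma> n * \<tau> n * real n = a"
    and "\<And>n. n \<ge> 1 \<Longrightarrow> prob_space (M n)"
    and "\<And>n. n \<ge> 1 \<Longrightarrow> prob_space.standard_brownian_motion (M n) (W n)"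
    and "\<And>n. n \<ge> 1 \<Longrightarrow> prob_space.stationary_OU (M n) (\<gamma> n) (\<sigma> n) (W n) (Z n)"
  shows "bdd_above (\<Lambda> \<rho> \<beta> a ` \<G>) \<and>
    (\<lambda>n. 1 / real n *
        ln (\<integral>\<omega>. prob_space.growth_process (M n) \<rho> (\<lambda>i. Z n (real i * \<tau> n)) n \<omega> \<partial>M n))
      \<longlonglongrightarrow> (SUP g\<in>\<G>. \<Lambda> \<rho> \<beta> a g)"
proof -
  note pos = assms(3,2)
  define P where "P n = ln (\<Sum>S\<in>Pow {..<n}. exp (gibbs_energy (ln \<rho>)
      (\<lambda>i j. \<beta> / real n * K a (real i / real n) (real j / real n)) S))" for n :: nat
  define L where "L n = ln (\<integral>\<omega>. prob_space.growth_process (M n) \<rho> (\<lambda>i. Z n (real i * \<tau> n)) n \<omega> \<partial>M n)" for n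
  define B where "B = (SUP g\<in>\<G>. \<Lambda> \<rho> \<beta> a g)"
  have lower: "real n * \<Lambda> \<rho> \<beta> a g \<le> P n + \<beta>" if "g \<in> \<G>" "n \<ge> 1" for g n
    unfolding P_def by (rule \<Lambda>_le_log_partition[OF that(1) pos that(2)])
  \<comment> \<open>A single site already suffices: the case \<open>n = 1\<close> bounds every
    \<open>\<Lambda>[g]\<close> by the finite number \<open>P 1 + \<beta>\<close>.\<close>
  have bdd: "bdd_above (\<Lambda> \<rho> \<beta> a ` \<G>)"
    using lower[of _ 1] by (intro bdd_aboveI[of _ "P 1 + \<beta>"]) auto
  have ne: "\<G> \<noteq> {}"
    using piecewise_linear_admissible(1)[of 1 "\<lambda>_. 0"] by auto
  have PB: "P n \<le> real n * B + \<beta> + 2 * \<beta> * real l + (real n / real l + 1) * ln (real n + 1)"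
    if "n \<ge> 1" "l \<ge> 1" for n l
    unfolding P_def
    by (rule log_partition_le_\<Lambda>[OF _ pos that]) (auto simp: B_def intro!: cSUP_upper bdd)
  \<comment> \<open>The error \<open>\<beta>\<close> does not depend on \<open>g\<close>, so the
    supremum can be taken at fixed \<open>n\<close>, before the limit.\<close>
  have BP: "real n * B \<le> P n + \<beta>" if n: "n \<ge> 1" for n
  proof -
    have "B \<le> (P n + \<beta>) / real n"
      unfolding B_def using lower[OF _ n] n by (intro cSUP_least ne) (simp add: le_divide_eq mult.commute)
    then show ?thesis using n by (simp add: le_divide_eq mult.commute)
  qed
  have LP: "L n \<le> P n" "P n - \<beta> / (2 * a) \<le> L n" if n: "n \<ge> 1" for n
  proof -
    interpret prob_space "M n" by (rule assms(7)[OF n])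
    note * = log_expectation_growth_bounds[OF assms(1) pos n _ _ _ assms(5)[OF n] assms(6)[OF n]
        assms(8)[OF n] assms(9)[OF n]]
    show "L n \<le> P n" "P n - \<beta> / (2 * a) \<le> L n"
      unfolding L_def P_def using assms(4)[OF n] by (intro *; blast)+
  qed
  have upper: "1 / real n * L n \<le> B + (\<beta> + 2 * \<beta> * (sqrt (real n) + 1)) / real n
      + (1 / sqrt (real n) + 1 / real n) * ln (real n + 1)" if n: "n \<ge> 1" for n
  proof -
    have n0: "real n > 0" using n by simp
    \<comment> \<open>This length makes the coarse-graining cost of order \<open>sqrt n\<close> and
      the counting cost of order \<open>sqrt n * ln n\<close>; after division by \<open>n\<close>
      both vanish.\<close>
    define l where "l = nat \<lceil>sqrt (real n)\<rceil>"
    have sq: "sqrt (real n) > 0" using n0 by simp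
    have l: "sqrt (real n) \<le> real l" "real l \<le> sqrt (real n) + 1"
      unfolding l_def using sq by linarith+
    have l0: "l > 0" using l(1) sq by (cases l) auto
    then have l1: "l \<ge> 1" by simp
    have expand: "real n * (B + x / real n + (s + 1 / real n) * y) = real n * B + x + (real n * s + 1) * y"
      for x y s :: real using n0 by (simp add: distrib_left distrib_right)
    have frac: "real n / real l \<le> real n / sqrt (real n)"
      by (rule divide_left_mono[OF l(1)]) (use sq l0 in \<open>simp_all add: n0\<close>)
    have "L n \<le> real n * B + \<beta> + 2 * \<beta> * real l + (real n / real l + 1) * ln (real n + 1)"
      using LP(1)[OF n] PB[OF n l1] by linarith
    also have "\<dots> \<le> real n * B + \<beta> + 2 * \<beta> * (sqrt (real n) + 1) + (real n / sqrt (real n) + 1) * ln (real n + 1)"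
      using l(2) pos frac n0 by (intro add_mono mult_left_mono mult_right_mono) auto
    also have "\<dots> = real n * (B + (\<beta> + 2 * \<beta> * (sqrt (real n) + 1)) / real n
      + (1 / sqrt (real n) + 1 / real n) * ln (real n + 1))"
      unfolding expand by simp
    finally show ?thesis using n0 by (simp add: divide_le_eq mult.commute)
  qed
  have lower: "B - (\<beta> + \<beta> / (2 * a)) / real n \<le> 1 / real n * L n" if n: "n \<ge> 1" for n
  proof -
    have "real n * B - (\<beta> + \<beta> / (2 * a)) \<le> L n" using BP[OF n] LP(2)[OF n] by linarith
    then have "(real n * B - (\<beta> + \<beta> / (2 * a))) / real n \<le> L n / real n"
      using n by (intro divide_right_mono) auto
    then show ?thesis using n by (simp add: diff_divide_distrib)
  qed
  have "(\<lambda>n. 1 / real n * L n) \<longlonglongrightarrow> B"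
  proof (rule tendsto_sandwich)
    show "\<forall>\<^sub>F n in sequentially. B - (\<beta> + \<beta> / (2 * a)) / real n \<le> 1 / real n * L n"
      using lower by (rule eventually_sequentiallyI)
    show "\<forall>\<^sub>F n in sequentially. 1 / real n * L n \<le> B + (\<beta> + 2 * \<beta> * (sqrt (real n) + 1)) / real n
      + (1 / sqrt (real n) + 1 / real n) * ln (real n + 1)"
      using upper by (rule eventually_sequentiallyI)
    show "(\<lambda>n. B - (\<beta> + \<beta> / (2 * a)) / real n) \<longlonglongrightarrow> B"
      by real_asymp
    show "(\<lambda>n. B + (\<beta> + 2 * \<beta> * (sqrt (real n) + 1)) / real n
      + (1 / sqrt (real n) + 1 / real n) * ln (real n + 1)) \<longlonglongrightarrow> B"
      by real_asymp
  qed
  with bdd show ?thesis unfolding L_def B_def by blast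
qed

end
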